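(* Let $0<\alpha<2$. Let $\rho_0$ be a smooth, $1$-periodic function on $\mathbb{R}$, not identically zero, satisfying (H1), (H2) and (H3). Then there is no classical (smooth) solution $\rho$ of the system $\partial_t\rho+\partial_x(\rho u)=0$, $u=H\Lambda^{\alpha-1}\rho$, on $\mathbb{T}\times[0,\infty)$ with $\rho(\cdot,0)=\rho_0$ such that $\sup_{t\ge 0}\|\rho(\cdot,t)\|_{C^1(\mathbb{T})}<\infty$. In other words, the solution loses uniform-in-time $C^1$ regularity (in finite time or as $t\to\infty$).
   Context: $\mathbb{T}=\mathbb{R}/\mathbb{Z}$, identified with $[-1/2,1/2)$; functions on $\mathbb{T}$ are identified with their $1$-periodic extensions to $\mathbb{R}$. For $0<\alpha<2$, $\Lambda^\alpha=(-\Delta)^{\alpha/2}$ is given by $\Lambda^\alpha f(x)=c_\alpha\,\mathrm{P.V.}\int_{\mathbb{R}}\frac{f(x)-f(y)}{|x-y|^{1+\alpha}}dy$ with a normalizing constant $c_\alpha>0$. $H$ is the Hilbert transform, and the velocity $u=H\Lambda^{\alpha-1}\rho$ has the integral representation $u(x,t)=c_\alpha\,\mathrm{P.V.}\int_{\mathbb{R}}\frac{\rho(y,t)-\rho(x,t)}{\mathrm{sgn}(x-y)\,|x-y|^{\alpha}}dy$. Equivalently the equation reads $\partial_t\rho+u\partial_x\rho=-\rho\Lambda^\alpha\rho$. Hypotheses on the initial datum: (H1) $\rho_0(x)=\rho_0(-x)$ for all $x$; (H2) $0\le\rho_0(x)\le\rho_{\max}$ for all $x$, for some constant $\rho_{\max}>0$;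 (H3) $\rho_0(0)=0$ and $\partial_x\rho_0(x)\ge0$ for all $x\in[0,1/2]$. *)

theory Defs
  imports "HOL-Analysis.Analysis"
begin

definition smooth_real :: "(real \<Rightarrow> real) \<Rightarrow> bool" where
  "smooth_real f \<longleftrightarrow> (\<forall>k x. ((deriv ^^ k) f) differentiable (at x))"

definition pdx :: "(real \<times> real \<Rightarrow> real) \<Rightarrow> real \<times> real \<Rightarrow> real" where
  "pdx g = (\<lambda>(x,t). deriv (\<lambda>y. g (y,t)) x)"

definition pdt :: "(real \<times> real \<Rightarrow> real) \<Rightarrow> real \<times> real \<Rightarrow> real" where
  "pdt g = (\<lambda>(x,t). THE d. ((\<lambda>s. g (x,s)) has_real_derivative d) (at t within {0..}))"

inductive_set partials :: "(real \<times> real \<Rightarrow> real) \<Rightarrow> (real \<times> real \<Rightarrow> real) set"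
  for g where
  base: "g \<in> partials g"
| dx: "f \<in> partials g \<Longrightarrow> pdx f \<in> partials g"
| dt: "f \<in> partials g \<Longrightarrow> pdt f \<in> partials g"

definition smooth_half :: "(real \<times> real \<Rightarrow> real) \<Rightarrow> bool" where
  "smooth_half g \<longleftrightarrow>
     (\<forall>f \<in> partials g.
        continuous_on (UNIV \<times> {0..}) f \<and>
        (\<forall>x t. t \<ge> 0 \<longrightarrow>
           (\<lambda>y. f (y,t)) differentiable (at x) \<and>
           (\<lambda>s. f (x,s)) differentiable (at t within {0..})))"

definition pv_integral :: "(real \<Rightarrow> real) \<Rightarrow> real \<Rightarrow> real" where
  "pv_integral K x =
     Lim (at_right 0) (\<lambda>\<epsilon>. Lim at_top (\<lambda>R.
        LINT y:{y. \<epsilon> < \<bar>x - y\<bar> \<and> \<bar>x - y\<bar> < R}|lborel. K y))"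

text \<open>Velocity u = H Lambda^(alpha-1) rho via its integral representation,
  with normalizing constant c.\<close>
definition velocity :: "real \<Rightarrow> real \<Rightarrow> (real \<Rightarrow> real) \<Rightarrow> real \<Rightarrow> real" where
  "velocity c \<alpha> f x =
     c * pv_integral (\<lambda>y. (f y - f x) / (sgn (x - y) * \<bar>x - y\<bar> powr \<alpha>)) x"

end

theory Submission
  imports Defs
begin

text \<open>
  The vacuum is attracting. If \<open>X\<close> follows a zero of \<open>\<rho>\<close> along the velocity field, then \<open>\<rho> (X t) t\<close>
  stays zero, and \<open>r x t = \<rho> (x + X t) t\<close> solves \<open>r_t + (r v)_x = 0\<close> with the relative velocity
  \<open>v x t = u (x + X t) t - u (X t) t\<close>. Writing \<open>v\<close> as an integral of \<open>r\<close> against a kernel and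
  symmetrizing in the two points, the potential energy \<open>G t = \<integral>\<^sub>0\<^sup>a r x t * \<phi> x\<close> with
  \<open>\<phi> x \<approx> x powr - \<alpha> / \<alpha>\<close> near the vacuum satisfies \<open>G' \<ge> l * G\<close> up to an arbitrarily small error:
  mass at distance at least \<open>a\<close> pulls \<open>r\<close> towards \<open>0\<close> at rate at least a multiple of \<open>x\<close>, and the mutual
  interactions inside \<open>(0, a)\<close> are favourable for \<open>\<alpha> \<ge> 1\<close> and negligible for small \<open>a\<close> if \<open>\<alpha> < 1\<close>.
  A uniform Lipschitz bound gives \<open>r x t \<le> M * x\<close> and hence, as \<open>\<alpha> < 2\<close>, a bound for \<open>G\<close> that does not
  depend on time; this contradicts the exponential growth.
\<close>

section \<open>Ordinary differential equations and Gronwall estimates\<close>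

text \<open>For f the density seen from the vacuum, the pull on x > 0 towards the vacuum is the
  integral of f y * (K (y - x) - K y) with K z = sgn z * |z| powr - \<alpha>. This is favourable for
  y < 0 and for y > x; only mass between the vacuum and x has the wrong sign, which is why pairs of
  points are weighed as a whole instead of estimating the velocity at each x. The exact power
  potential is unbounded at the vacuum. It is capped at scale \<delta>, and the kernel is truncated
  at \<epsilon> and R until the symmetrization is done, so that differentiation under the integral
  and Fubini apply to bounded functions. The cost of the cap is controlled by f x \<le>
  \<open>B * x\<^sup>2\<close>, where B bounds the second derivative on {0..T} and may grow with T.
  Hence the order of choices: a and the mass m are fixed from M, \<alpha> and the initial density;
  they determine the growth rate and the ceiling of the energy, these determine T, then comes B, and
  \<delta> is last. The ceiling may involve neither B nor \<delta>, so it has to rest on the linear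
  bound.\<close>

lemma ode_exists:
  fixes U :: "real \<Rightarrow> real \<Rightarrow> real" and T L x0 :: real
  assumes "0 \<le> T"
    and cont: "continuous_on (UNIV \<times> {0..T}) (\<lambda>(x, t). U x t)"
    and lip: "\<And>x y t. t \<in> {0..T} \<Longrightarrow> \<bar>U x t - U y t\<bar> \<le> L * \<bar>x - y\<bar>"
  obtains X where "X 0 = x0"
    "\<And>t. t \<in> {0..T} \<Longrightarrow> (X has_real_derivative U (X t) t) (at t within {0..T})"
proof -
  \<comment> \<open>Picard iteration in a weighted norm: the unknown is Y = exp (- K * t) * (X -
    x0), and with this K the fixed-point map contracts by 1/2 on all of {0..T}, however large T is,
    so no short-time solutions have to be glued.\<close>
  define K where "K = 2 * (\<bar>L\<bar> + 1)"
  have K: "K > 0" "\<bar>L\<bar> \<le> K / 2" by (auto simp: K_def)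
  \<comment> \<open>\<open>clp\<close> freezes time outside {0..T}; the iterates become bounded
    continuous functions on the whole line, which form a complete space.\<close>
  define clp where "clp t = max 0 (min T t)" for t :: real
  have clp: "clp t \<in> {0..T}" for t using \<open>0 \<le> T\<close> by (auto simp: clp_def)
  have clp_id: "clp t = t" if "t \<in> {0..T}" for t using that by (auto simp: clp_def)
  define h where "h Y s = U (x0 + exp (K * s) * Y s) s" for Y s
  have h_cont: "continuous_on {0..T} (h Y)" if "continuous_on UNIV Y" for Y
    unfolding h_def
    by (rule continuous_on_compose2[OF cont, where f = "\<lambda>s. (x0 + exp (K * s) * Y s, s)", simplified])
      (auto intro!: continuous_intros continuous_on_subset[OF that])
  define \<Phi>0 where "\<Phi>0 Y t = exp (- K * clp t) * integral {0..clp t} (h Y)" for Y t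
  have int_cont: "continuous_on {0..T} (\<lambda>t. integral {0..t} (h Y))" if "continuous_on UNIV Y" for Y
    by (rule indefinite_integral_continuous_1) (intro integrable_continuous_interval h_cont that)
  have clp_cont: "continuous_on UNIV clp"
    unfolding clp_def by (intro continuous_intros)
  have \<Phi>0_in: "\<Phi>0 (apply_bcontfun Y) \<in> bcontfun" for Y :: "real \<Rightarrow>\<^sub>C real"
  proof -
    let ?g = "\<lambda>t. exp (- K * t) * integral {0..t} (h (apply_bcontfun Y))"
    have g: "continuous_on {0..T} ?g"
      by (intro continuous_intros int_cont) auto
    have eq: "\<Phi>0 (apply_bcontfun Y) = (\<lambda>t. ?g (clp t))" by (simp add: \<Phi>0_def fun_eq_iff)
    have "continuous_on UNIV (\<lambda>t. ?g (clp t))"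
      by (rule continuous_on_compose2[OF g clp_cont]) (use clp in auto)
    moreover have "bounded (?g ` {0..T})"
      by (intro compact_imp_bounded compact_continuous_image g) auto
    then have "bounded (range (\<lambda>t. ?g (clp t)))"
      by (rule bounded_subset) (use clp in auto)
    ultimately show ?thesis by (auto simp: bcontfun_def eq)
  qed
  define \<Phi> :: "(real \<Rightarrow>\<^sub>C real) \<Rightarrow> (real \<Rightarrow>\<^sub>C real)" where "\<Phi> Y = Bcontfun (\<Phi>0 Y)" for Y
  have app: "apply_bcontfun (\<Phi> Y) = \<Phi>0 Y" for Y
    unfolding \<Phi>_def by (rule Bcontfun_inverse[OF \<Phi>0_in])
  have contr: "dist (\<Phi> Y) (\<Phi> Z) \<le> 1/2 * dist Y Z" for Y Z
  proof (rule dist_bound)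
    fix t
    define s where "s = clp t"
    have s: "s \<in> {0..T}" using clp by (simp add: s_def)
    have hc: "continuous_on {0..s} (h (apply_bcontfun Y))" for Y :: "real \<Rightarrow>\<^sub>C real"
      using s by (intro continuous_on_subset[OF h_cont]) auto
    have pt: "\<bar>h Y r - h Z r\<bar> \<le> K / 2 * dist Y Z * exp (K * r)" if "r \<in> {0..s}" for r
    proof -
      have "\<bar>h Y r - h Z r\<bar> \<le> L * \<bar>exp (K * r) * Y r - exp (K * r) * Z r\<bar>"
        unfolding h_def using lip[of r "x0 + exp (K * r) * Y r" "x0 + exp (K * r) * Z r"] that s by auto
      also have "\<dots> = L * (exp (K * r) * \<bar>Y r - Z r\<bar>)"
        by (simp add: right_diff_distrib[symmetric] abs_mult)
      also have "\<dots> \<le> K / 2 * (exp (K * r) * dist Y Z)"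
        using K dist_bounded[of Y r Z]
        by (intro mult_mono) (auto simp: dist_real_def)
      finally show ?thesis by (simp add: mult_ac)
    qed
    have E: "((\<lambda>r. K / 2 * dist Y Z * exp (K * r)) has_integral
        (dist Y Z / 2 * exp (K * s) - dist Y Z / 2 * exp (K * 0))) {0..s}"
      using s by (intro fundamental_theorem_of_calculus)
        (auto simp flip: has_real_derivative_iff_has_vector_derivative intro!: derivative_eq_intros)
    have "\<bar>integral {0..s} (h Y) - integral {0..s} (h Z)\<bar>
        = \<bar>integral {0..s} (\<lambda>r. h Y r - h Z r)\<bar>"
      by (subst integral_diff) (auto intro!: integrable_continuous_interval hc)
    also have "\<dots> \<le> integral {0..s} (\<lambda>r. K / 2 * dist Y Z * exp (K * r))"
      using pt E by (intro integral_norm_bound_integral[where 'a = real, unfolded real_norm_def])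
        (auto intro!: integrable_continuous_interval continuous_intros hc)
    also have "\<dots> \<le> dist Y Z / 2 * exp (K * s)"
      unfolding integral_unique[OF E] by simp
    finally have "exp (- K * s) * \<bar>integral {0..s} (h Y) - integral {0..s} (h Z)\<bar>
        \<le> exp (- K * s) * (dist Y Z / 2 * exp (K * s))"
      by (intro mult_left_mono) auto
    also have "\<dots> = 1/2 * dist Y Z" by (simp add: exp_minus field_simps)
    finally show "dist (\<Phi> Y t) (\<Phi> Z t) \<le> 1/2 * dist Y Z"
      by (simp add: app \<Phi>0_def s_def dist_real_def abs_mult flip: right_diff_distrib)
  qed
  obtain Y where Y: "\<Phi> Y = Y"
    using banach_fix_type[of "1/2" \<Phi>] contr by auto
  define X where "X t = x0 + exp (K * t) * Y t" for t
  have X_eq: "X t = x0 + integral {0..t} (\<lambda>s. U (X s) s)" if "t \<in> {0..T}" for t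
  proof -
    have "Y t = exp (- K * t) * integral {0..t} (h Y)"
      using arg_cong[OF app[of Y], of "\<lambda>g. g t"] Y that by (simp add: \<Phi>0_def clp_id)
    then show ?thesis by (simp add: X_def h_def[abs_def] exp_minus field_simps)
  qed
  show ?thesis
  proof (rule that[of X])
    show "X 0 = x0" using X_eq[of 0] \<open>0 \<le> T\<close> by simp
    fix t assume t: "t \<in> {0..T}"
    have "continuous_on {0..T} (\<lambda>s. U (X s) s)"
      using h_cont[of Y] by (simp add: h_def[abs_def] X_def)
    then have "((\<lambda>t. integral {0..t} (\<lambda>s. U (X s) s)) has_real_derivative U (X t) t) (at t within {0..T})"
      by (rule integral_has_real_derivative) (use t in auto)
    then have "((\<lambda>t. x0 + integral {0..t} (\<lambda>s. U (X s) s)) has_real_derivative U (X t) t) (at t within {0..T})"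
      by (auto intro!: derivative_eq_intros)
    then show "(X has_real_derivative U (X t) t) (at t within {0..T})"
      using t X_eq by (rule_tac has_field_derivative_transform_within[where d = 1]) auto
  qed
qed

lemma nondecreasing_within:
  fixes H h :: "real \<Rightarrow> real"
  assumes "a \<le> b"
    and d: "\<And>t. t \<in> {a..b} \<Longrightarrow> (H has_real_derivative h t) (at t within {a..b})"
    and nn: "\<And>t. t \<in> {a..b} \<Longrightarrow> h t \<ge> 0"
  shows "H a \<le> H b"
proof (cases "a = b")
  case False
  then have "a < b" using \<open>a \<le> b\<close> by simp
  then obtain t where "t \<in> {a<..<b}" "H b - H a = h t * (b - a)"
    using mvt_simple[of a b H "\<lambda>t x. h t * x"] d by (auto simp: has_field_derivative_def)
  then show ?thesis using nn[of t] \<open>a < b\<close> by (smt (verit) greaterThanLessThan_iff atLeastAtMost_iff mult_nonneg_nonneg)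
qed auto

text \<open>exp (- 2 * L * t) * (w t)^2 is nonincreasing; the square avoids differentiating |w| at a
  zero.\<close>

lemma gronwall_zero:
  fixes w w' :: "real \<Rightarrow> real"
  assumes d: "\<And>t. t \<in> {0..T} \<Longrightarrow> (w has_real_derivative w' t) (at t within {0..T})"
    and b: "\<And>t. t \<in> {0..T} \<Longrightarrow> \<bar>w' t\<bar> \<le> L * \<bar>w t\<bar>"
    and st: "0 \<le> s" "s \<le> t" "t \<le> T" and "w s = 0"
  shows "w t = 0"
proof -
  define H where "H t = - exp (- 2 * L * t) * (w t)\<^sup>2" for t
  have "(H has_real_derivative (2 * exp (- 2 * L * r) * (L * \<bar>w r\<bar> * \<bar>w r\<bar> - w' r * w r))) (at r within {s..t})"
    if "r \<in> {s..t}" for r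
    unfolding H_def using that st
    by (auto intro!: derivative_eq_intros DERIV_subset[OF d] simp: algebra_simps power2_eq_square)
  moreover have "2 * exp (- 2 * L * r) * (L * \<bar>w r\<bar> * \<bar>w r\<bar> - w' r * w r) \<ge> 0" if "r \<in> {s..t}" for r
  proof -
    have "w' r * w r \<le> \<bar>w' r\<bar> * \<bar>w r\<bar>" by (metis abs_ge_self abs_mult)
    also have "\<dots> \<le> L * \<bar>w r\<bar> * \<bar>w r\<bar>" using b[of r] that st by (intro mult_right_mono) auto
    finally show ?thesis by simp
  qed
  ultimately have "H s \<le> H t" by (rule nondecreasing_within[OF \<open>s \<le> t\<close>])
  then have "(w t)\<^sup>2 \<le> 0" using \<open>w s = 0\<close> by (simp add: H_def mult_le_0_iff)
  then show ?thesis by simp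
qed

text \<open>To become negative w must first vanish, and by \<open>gronwall_zero\<close> it then
  stays zero.\<close>

lemma gronwall_nonneg:
  fixes w w' :: "real \<Rightarrow> real"
  assumes d: "\<And>t. t \<in> {0..T} \<Longrightarrow> (w has_real_derivative w' t) (at t within {0..T})"
    and b: "\<And>t. t \<in> {0..T} \<Longrightarrow> \<bar>w' t\<bar> \<le> L * \<bar>w t\<bar>"
    and "0 \<le> T" "0 \<le> w 0"
  shows "0 \<le> w T"
proof (rule ccontr)
  assume "\<not> 0 \<le> w T"
  moreover have "continuous_on {0..T} w"
    using d by (meson DERIV_continuous continuous_on_eq_continuous_within)
  ultimately obtain s where "0 \<le> s" "s \<le> T" "w s = 0"
    using IVT2'[of w T 0 0] assms by auto
  then have "w T = 0" using gronwall_zero[OF d b, of s T] by auto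
  then show False using \<open>\<not> 0 \<le> w T\<close> by simp
qed

text \<open>Shifting by the equilibrium value e / l makes the inequality homogeneous.\<close>

lemma gronwall_lower:
  fixes G G' :: "real \<Rightarrow> real"
  assumes d: "\<And>t. t \<in> {0..T} \<Longrightarrow> (G has_real_derivative G' t) (at t within {0..T})"
    and b: "\<And>t. t \<in> {0..T} \<Longrightarrow> G' t \<ge> l * G t - e"
    and "l > 0" "0 \<le> T"
  shows "G T - e / l \<ge> exp (l * T) * (G 0 - e / l)"
proof -
  define H where "H t = exp (- l * t) * (G t - e / l)" for t
  have dH: "(H has_real_derivative exp (- l * t) * (G' t - l * G t + e)) (at t within {0..T})"
    if "t \<in> {0..T}" for t
    unfolding H_def using that \<open>l > 0\<close>
    by (auto intro!: derivative_eq_intros d simp: field_simps)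
  have "H 0 \<le> H T"
    using \<open>0 \<le> T\<close>
  proof (rule nondecreasing_within[OF _ dH])
    fix t assume "t \<in> {0..T}"
    from b[OF this] show "exp (- l * t) * (G' t - l * G t + e) \<ge> 0" by (intro mult_nonneg_nonneg) auto
  qed
  then have "exp (l * T) * (G 0 - e / l) \<le> exp (l * T) * (exp (- l * T) * (G T - e / l))"
    by (intro mult_left_mono) (auto simp: H_def)
  then show ?thesis by (simp add: mult.assoc[symmetric] exp_minus_inverse)
qed

section \<open>The principal value integral\<close>

text \<open>Oddness and periodicity give mean value zero, so the antiderivative Q is itself periodic
  and is bounded by its values on one period, at most G. A difference of two values gives the factor
  2.\<close>

lemma odd_periodic_integral_bound:
  fixes g :: "real \<Rightarrow> real"
  assumes cont: "continuous_on UNIV g"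
    and per: "\<And>z. g (z + 1) = g z" and odd: "\<And>z. g (- z) = - g z"
    and bd: "\<And>z. \<bar>g z\<bar> \<le> G"
    and ab: "0 \<le> a" "a \<le> b"
  shows "\<bar>integral {a..b} g\<bar> \<le> 2 * G"
proof -
  have co: "continuous_on S g" for S using cont continuous_on_subset by blast
  have io: "g integrable_on {c..d}" for c d
    by (intro integrable_continuous_interval co)
  define Q where "Q q = integral {0..q} g" for q
  have shift: "integral {p..q} g = integral {p+1..q+1} g" for p q
    using integral_shift_Icc_real[of p q g 1] by (simp add: o_def per add.commute)
  have "integral {0..1} g = integral {-1..0} (\<lambda>z. g (- z))"
    using Henstock_Kurzweil_Integration.integral_reflect_real[of 1 0 g] by simp
  also have "\<dots> = - integral {-1..0} g" by (simp add: odd)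
  also have "integral {-1..0} g = integral {0..1} g" using shift[of "-1" 0] by simp
  finally have Q1: "integral {0..1} g = 0" by simp
  have Qper: "Q (q + 1) = Q q" if "q \<ge> 0" for q
  proof -
    have "Q (q + 1) = integral {0..1} g + integral {1..q+1} g"
      unfolding Q_def using that by (intro Henstock_Kurzweil_Integration.integral_combine[symmetric] io) auto
    then show ?thesis using Q1 shift[of 0 q] by (simp add: Q_def)
  qed
  have Qper': "Q (q + real n) = Q q" if "q \<ge> 0" for q n
  proof (induction n)
    case (Suc n) then show ?case using Qper[of "q + real n"] that by (simp add: add_ac)
  qed simp
  have Qb: "\<bar>Q q\<bar> \<le> G" if "q \<ge> 0" for q
  proof -
    have fr: "0 \<le> frac q" "frac q \<le> 1" by (auto simp: frac_ge_0 frac_lt_1 less_imp_le)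
    have "q = frac q + real (nat \<lfloor>q\<rfloor>)" using that by (simp add: frac_def)
    then have "Q q = Q (frac q)" using Qper'[OF fr(1), of "nat \<lfloor>q\<rfloor>"] by metis
    also have "\<bar>Q (frac q)\<bar> \<le> G * (frac q - 0)"
      using integral_bound[of 0 "frac q" g G] fr co bd by (auto simp: Q_def)
    also have "\<dots> \<le> G * 1" using fr bd[of 0] by (intro mult_left_mono) auto
    finally show ?thesis by simp
  qed
  have "Q b = Q a + integral {a..b} g"
    unfolding Q_def using ab by (intro Henstock_Kurzweil_Integration.integral_combine[symmetric] io) auto
  then show ?thesis using Qb[of a] Qb[of b] ab by auto
qed

text \<open>For \<alpha> \<le> 1 the tail need not converge absolutely, so cancellation is
  essential. The second mean value theorem moves the monotone factor z powr - \<alpha> outside and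
  leaves integrals of g alone.\<close>

lemma odd_periodic_tail_bound:
  fixes g :: "real \<Rightarrow> real"
  assumes cont: "continuous_on UNIV g"
    and per: "\<And>z. g (z + 1) = g z" and odd: "\<And>z. g (- z) = - g z"
    and bd: "\<And>z. \<bar>g z\<bar> \<le> G"
    and ab: "0 < a" "a \<le> b" and "0 < \<alpha>"
  shows "\<bar>integral {a..b} (\<lambda>z. g z * z powr - \<alpha>)\<bar> \<le> 4 * G * a powr - \<alpha>"
proof -
  have G: "G \<ge> 0" using bd[of 0] by auto
  have mono: "- (x powr - \<alpha>) \<le> - (y powr - \<alpha>)" if "a \<le> x" "x \<le> y" for x y
    using that ab \<open>0 < \<alpha>\<close> by (simp add: powr_mono2')
  obtain c where c: "c \<in> {a..b}"
    "((\<lambda>x. - (x powr - \<alpha>) * g x) has_integral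
       (- (a powr - \<alpha>) * integral {a..c} g + - (b powr - \<alpha>) * integral {c..b} g)) {a..b}"
    by (rule second_mean_value_theorem_full[of g a b "\<lambda>x. - (x powr - \<alpha>)"])
      (use mono ab cont in \<open>auto intro!: integrable_continuous_interval intro: continuous_on_subset\<close>)
  have "integral {a..b} (\<lambda>z. g z * z powr - \<alpha>) = a powr - \<alpha> * integral {a..c} g + b powr - \<alpha> * integral {c..b} g"
    using integral_unique[OF has_integral_neg[OF c(2)]] by (simp add: mult.commute)
  also have "\<bar>\<dots>\<bar> \<le> a powr - \<alpha> * \<bar>integral {a..c} g\<bar> + b powr - \<alpha> * \<bar>integral {c..b} g\<bar>"
    by (rule order.trans[OF abs_triangle_ineq]) (simp add: abs_mult)
  also have "\<dots> \<le> a powr - \<alpha> * (2 * G) + a powr - \<alpha> * (2 * G)"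
    using c(1) ab mono[of a b] G
    by (intro add_mono mult_mono odd_periodic_integral_bound cont per odd bd) auto
  finally show ?thesis by simp
qed

text \<open>A Cauchy criterion whose modulus e survives in the limit. It serves for R tending to
  infinity and, with 1 / \<epsilon> as the variable, for \<epsilon> tending to 0.\<close>

lemma cauchy_at_top_limit:
  fixes h e :: "real \<Rightarrow> real"
  assumes e: "(e \<longlongrightarrow> 0) at_top"
    and cau: "\<And>R S. R0 \<le> R \<Longrightarrow> R \<le> S \<Longrightarrow> \<bar>h R - h S\<bar> \<le> e R"
  shows "\<exists>l. (h \<longlongrightarrow> l) at_top \<and> (\<forall>R\<ge>R0. \<bar>h R - l\<bar> \<le> e R)"
proof -
  define X where "X n = h (R0 + real n)" for n
  have ft: "filterlim (\<lambda>n. R0 + real n) at_top sequentially"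
    by (intro filterlim_tendsto_add_at_top[OF tendsto_const] filterlim_real_sequentially)
  have "Cauchy X"
  proof (rule metric_CauchyI)
    fix r :: real assume "0 < r"
    then have "eventually (\<lambda>n. dist (e (R0 + real n)) 0 < r / 2) sequentially"
      by (intro tendstoD[OF filterlim_compose[OF e ft]]) auto
    then obtain N where N: "\<bar>e (R0 + real N)\<bar> < r / 2"
      by (auto simp: eventually_sequentially dist_real_def)
    have *: "\<bar>X N - X n\<bar> < r / 2" if "n \<ge> N" for n
      using cau[of "R0 + real N" "R0 + real n"] that N unfolding X_def by auto
    show "\<exists>M. \<forall>m\<ge>M. \<forall>n\<ge>M. dist (X m) (X n) < r"
    proof (intro exI allI impI)
      fix m n assume "m \<ge> N" "n \<ge> N"
      then show "dist (X m) (X n) < r" using *[of m] *[of n] unfolding dist_real_def by linarith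
    qed
  qed
  then obtain l where l: "X \<longlonglongrightarrow> l" using Cauchy_convergent convergent_def by blast
  have bd: "\<bar>h R - l\<bar> \<le> e R" if "R0 \<le> R" for R
  proof (rule tendsto_upperbound)
    show "((\<lambda>n. \<bar>h R - X n\<bar>) \<longlongrightarrow> \<bar>h R - l\<bar>) sequentially"
      by (intro tendsto_intros l)
    have "eventually (\<lambda>n. R \<le> R0 + real n) sequentially"
      using ft by (auto simp: filterlim_at_top)
    then show "eventually (\<lambda>n. \<bar>h R - X n\<bar> \<le> e R) sequentially"
      by eventually_elim (use cau that in \<open>auto simp: X_def\<close>)
  qed auto
  have "((\<lambda>R. h R - l) \<longlongrightarrow> 0) at_top"
    by (rule Lim_null_comparison[OF _ e]) (use bd in \<open>auto simp: eventually_at_top_linorder\<close>)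
  then have "(h \<longlongrightarrow> l) at_top" using LIM_zero_iff by blast
  with bd show ?thesis by blast
qed

text \<open>The points x - z and x + z are folded together. The odd kernel cancels the constant f x
  of the velocity integrand, which therefore does not appear.\<close>

definition sym_int :: "real \<Rightarrow> (real \<Rightarrow> real) \<Rightarrow> real \<Rightarrow> real \<Rightarrow> real \<Rightarrow> real" where
  "sym_int \<alpha> f x \<epsilon> R = integral {\<epsilon>..R} (\<lambda>z. (f (x - z) - f (x + z)) * z powr - \<alpha>)"

lemma punctured_integral:
  fixes f :: "real \<Rightarrow> real"
  assumes cont: "continuous_on UNIV f" and eR: "0 < \<epsilon>"
  shows "(LINT y:{y. \<epsilon> < \<bar>x - y\<bar> \<and> \<bar>x - y\<bar> < R}|lborel. f y * (sgn (x - y) * \<bar>x - y\<bar> powr - \<alpha>))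
       = sym_int \<alpha> f x \<epsilon> R"
proof -
  define k where "k y = f y * (sgn (x - y) * \<bar>x - y\<bar> powr - \<alpha>)" for y
  have set: "{y. \<epsilon> < \<bar>x - y\<bar> \<and> \<bar>x - y\<bar> < R} = {x - R<..<x - \<epsilon>} \<union> {x + \<epsilon><..<x + R}"
    using eR by auto
  have k1: "continuous_on {x - R..x - \<epsilon>} k"
  proof -
    have "continuous_on {x - R..x - \<epsilon>} (\<lambda>y. f y * (x - y) powr - \<alpha>)"
      using eR by (auto intro!: continuous_intros continuous_on_subset[OF cont])
    then show ?thesis
      by (rule continuous_on_eq) (use eR in \<open>auto simp: k_def\<close>)
  qed
  have k2: "continuous_on {x + \<epsilon>..x + R} k"
  proof -
    have "continuous_on {x + \<epsilon>..x + R} (\<lambda>y. - f y * (y - x) powr - \<alpha>)"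
      using eR by (auto intro!: continuous_intros continuous_on_subset[OF cont])
    then show ?thesis
      by (rule continuous_on_eq) (use eR in \<open>auto simp: k_def abs_if\<close>)
  qed
  have s1: "set_integrable lborel {x - R<..<x - \<epsilon>} k"
    by (rule set_integrable_subset[OF borel_integrable_atLeastAtMost'[OF k1]]) auto
  have s2: "set_integrable lborel {x + \<epsilon><..<x + R} k"
    by (rule set_integrable_subset[OF borel_integrable_atLeastAtMost'[OF k2]]) auto
  have sh: "integral {\<epsilon>..R} (\<lambda>z. h (x + z)) = integral {x + \<epsilon>..x + R} h"
    for h :: "real \<Rightarrow> real"
    using integral_shift_Icc_real[of \<epsilon> R h x] by (simp add: o_def add.commute)
  have sh': "integral {\<epsilon>..R} (\<lambda>z. h (x - z)) = integral {x - R..x - \<epsilon>} h"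
    for h :: "real \<Rightarrow> real"
    using integral_shift_Icc_real[of "-R" "-\<epsilon>" h x] Henstock_Kurzweil_Integration.integral_reflect_real[of R \<epsilon> "\<lambda>z. h (x - z)"]
    by (simp add: o_def add.commute)
  have "(LINT y:{x - R<..<x - \<epsilon>} \<union> {x + \<epsilon><..<x + R}|lborel. k y)
     = (LINT y:{x - R<..<x - \<epsilon>}|lborel. k y) + (LINT y:{x + \<epsilon><..<x + R}|lborel. k y)"
    using eR by (intro set_integral_Un s1 s2) auto
  also have "(LINT y:{x - R<..<x - \<epsilon>}|lborel. k y) = integral {x - R..x - \<epsilon>} k"
    using set_borel_integral_eq_integral(2)[OF s1] by (simp add: integral_open_interval_real)
  also have "(LINT y:{x + \<epsilon><..<x + R}|lborel. k y) = integral {x + \<epsilon>..x + R} k"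
    using set_borel_integral_eq_integral(2)[OF s2] by (simp add: integral_open_interval_real)
  also have "integral {x - R..x - \<epsilon>} k = integral {\<epsilon>..R} (\<lambda>z. k (x - z))"
    by (rule sh'[symmetric])
  also have "integral {x + \<epsilon>..x + R} k = integral {\<epsilon>..R} (\<lambda>z. k (x + z))"
    by (rule sh[symmetric])
  also have "integral {\<epsilon>..R} (\<lambda>z. k (x - z)) + integral {\<epsilon>..R} (\<lambda>z. k (x + z))
      = integral {\<epsilon>..R} (\<lambda>z. k (x - z) + k (x + z))"
    by (intro integral_add[symmetric] integrable_continuous_interval continuous_on_compose2[OF k1] continuous_on_compose2[OF k2] continuous_intros) auto
  also have "\<dots> = sym_int \<alpha> f x \<epsilon> R"
    unfolding sym_int_def using eR
    by (intro integral_cong) (auto simp: k_def algebra_simps)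
  finally show ?thesis unfolding set k_def .
qed

section \<open>Convergence of the principal value, with a rate uniform in x\<close>

locale periodic_lipschitz =
  fixes \<alpha> M0 M1 :: real and f :: "real \<Rightarrow> real"
  assumes alpha: "0 < \<alpha>" "\<alpha> < 2"
    and per: "\<And>x. f (x + 1) = f x"
    and bd: "\<And>x. \<bar>f x\<bar> \<le> M0"
    and lip: "\<And>x y. \<bar>f x - f y\<bar> \<le> M1 * \<bar>x - y\<bar>"
begin

lemma M0: "0 \<le> M0" using bd[of 0] by auto

lemma M1: "0 \<le> M1" using lip[of 0 1] by auto

lemma cont: "continuous_on S f"
proof -
  have "M1-lipschitz_on S f"
    by (rule lipschitz_onI) (use lip M1 in \<open>auto simp: dist_real_def\<close>)
  then show ?thesis by (rule lipschitz_on_continuous_on)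
qed

lemma per': "f (x - 1) = f x" using per[of "x - 1"] by simp

lemma integrand_cont: "continuous_on {a..b} (\<lambda>z. (f (x - z) - f (x + z)) * z powr - \<alpha>)" if "0 < a"
  using that by (auto intro!: continuous_intros continuous_on_compose2[OF cont])

lemma sym_int_combine:
  "sym_int \<alpha> f x a c = sym_int \<alpha> f x a b + sym_int \<alpha> f x b c" if "0 < a" "a \<le> b" "b \<le> c"
  using Henstock_Kurzweil_Integration.integral_combine[OF that(2,3) integrable_continuous_interval[OF integrand_cont[OF that(1)]]]
  by (simp add: sym_int_def)

lemma sym_int_tail:
  assumes "0 < R" "R \<le> S"
  shows "\<bar>sym_int \<alpha> f x R S\<bar> \<le> 8 * M0 * R powr - \<alpha>"
proof -
  have "\<bar>sym_int \<alpha> f x R S\<bar> \<le> 4 * (2 * M0) * R powr - \<alpha>"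
    unfolding sym_int_def
  proof (rule odd_periodic_tail_bound)
    show "continuous_on UNIV (\<lambda>z. f (x - z) - f (x + z))"
      by (intro continuous_intros continuous_on_compose2[OF cont]) auto
    show "f (x - (z + 1)) - f (x + (z + 1)) = f (x - z) - f (x + z)" for z
      using per'[of "x - z"] per[of "x + z"] by (simp add: algebra_simps)
    show "\<bar>f (x - z) - f (x + z)\<bar> \<le> 2 * M0" for z
      using bd[of "x - z"] bd[of "x + z"] by auto
  qed (use assms alpha in auto)
  then show ?thesis by simp
qed

text \<open>The symmetric difference is at most 2 * M1 * z, which gains one power of z; z powr (1 -
  \<alpha>) is integrable at 0 because \<alpha> < 2.\<close>

lemma sym_int_near:
  assumes "0 < a" "a \<le> b"
  shows "\<bar>sym_int \<alpha> f x a b\<bar> \<le> 2 * M1 / (2 - \<alpha>) * b powr (2 - \<alpha>)"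
proof -
  have pt: "\<bar>(f (x - z) - f (x + z)) * z powr - \<alpha>\<bar> \<le> 2 * M1 * z powr (1 - \<alpha>)" if "z \<in> {a..b}" for z
  proof -
    have z: "z > 0" using that assms by auto
    have "\<bar>(f (x - z) - f (x + z)) * z powr - \<alpha>\<bar> = \<bar>f (x - z) - f (x + z)\<bar> * z powr - \<alpha>"
      by (simp add: abs_mult)
    also have "\<dots> \<le> (2 * M1 * z) * z powr - \<alpha>"
      using lip[of "x - z" "x + z"] z by (intro mult_right_mono) (auto simp: mult_ac)
    also have "\<dots> = 2 * M1 * z powr (1 - \<alpha>)"
      using z powr_mult_base[of z "-\<alpha>"] by (simp add: mult.assoc)
    finally show ?thesis .
  qed
  have hi: "((\<lambda>z. 2 * M1 * z powr (1 - \<alpha>)) has_integral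
      (2 * M1 / (2 - \<alpha>) * b powr (2 - \<alpha>) - 2 * M1 / (2 - \<alpha>) * a powr (2 - \<alpha>))) {a..b}"
    using assms alpha by (intro fundamental_theorem_of_calculus)
      (auto simp flip: has_real_derivative_iff_has_vector_derivative intro!: derivative_eq_intros)
  have "\<bar>sym_int \<alpha> f x a b\<bar> \<le> integral {a..b} (\<lambda>z. 2 * M1 * z powr (1 - \<alpha>))"
    unfolding sym_int_def
    by (intro integral_norm_bound_integral[where 'a = real, unfolded real_norm_def] pt
        integrable_continuous_interval[OF integrand_cont[OF \<open>0 < a\<close>]] has_integral_integrable[OF hi])
  also have "\<dots> \<le> 2 * M1 / (2 - \<alpha>) * b powr (2 - \<alpha>)"
    unfolding integral_unique[OF hi] using M1 alpha by simp
  finally show ?thesis .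
qed

definition pv :: "real \<Rightarrow> real" where
  "pv x = pv_integral (\<lambda>y. (f y - f x) / (sgn (x - y) * \<bar>x - y\<bar> powr \<alpha>)) x"

text \<open>Both limits in \<open>pv_integral\<close> exist, so \<open>Lim\<close> has its intended
  value, and the rate depends on f only through M0 and M1. The inner limit I exists by the tail
  bound, the outer limit P by the bound near the singularity.\<close>

lemma pv_approx:
  assumes eR: "0 < \<epsilon>" "\<epsilon> \<le> 1" "1 \<le> R"
  shows "\<bar>sym_int \<alpha> f x \<epsilon> R - pv x\<bar> \<le> 2 * M1 / (2 - \<alpha>) * \<epsilon> powr (2 - \<alpha>) + 8 * M0 * R powr - \<alpha>"
proof -
  define A where "A = 2 * M1 / (2 - \<alpha>)"
  have powr0: "((\<lambda>R. R powr - \<beta>) \<longlongrightarrow> 0) at_top" if "\<beta> > 0" for \<beta> :: real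
    using that by (intro tendsto_neg_powr filterlim_ident) auto
  have "\<exists>l. ((\<lambda>R. sym_int \<alpha> f x \<epsilon> R) \<longlongrightarrow> l) at_top \<and> (\<forall>R\<ge>1. \<bar>sym_int \<alpha> f x \<epsilon> R - l\<bar> \<le> 8 * M0 * R powr - \<alpha>)"
    if "0 < \<epsilon>" "\<epsilon> \<le> 1" for \<epsilon>
    proof (rule cauchy_at_top_limit)
      show "((\<lambda>R. 8 * M0 * R powr - \<alpha>) \<longlongrightarrow> 0) at_top"
        using tendsto_mult_left[OF powr0[of \<alpha>], of "8 * M0"] alpha by simp
      show "\<bar>sym_int \<alpha> f x \<epsilon> R - sym_int \<alpha> f x \<epsilon> S\<bar> \<le> 8 * M0 * R powr - \<alpha>" if "1 \<le> R" "R \<le> S" for R S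
        using sym_int_combine[of \<epsilon> R S x] sym_int_tail[of R S x] that \<open>0 < \<epsilon>\<close> \<open>\<epsilon> \<le> 1\<close> by auto
    qed
  then obtain I where I: "\<And>\<epsilon>. 0 < \<epsilon> \<Longrightarrow> \<epsilon> \<le> 1 \<Longrightarrow> ((\<lambda>R. sym_int \<alpha> f x \<epsilon> R) \<longlongrightarrow> I \<epsilon>) at_top"
    and I': "\<And>\<epsilon> R. 0 < \<epsilon> \<Longrightarrow> \<epsilon> \<le> 1 \<Longrightarrow> 1 \<le> R \<Longrightarrow> \<bar>sym_int \<alpha> f x \<epsilon> R - I \<epsilon>\<bar> \<le> 8 * M0 * R powr - \<alpha>"
    by metis
  have Idiff: "\<bar>I \<epsilon> - I \<epsilon>'\<bar> \<le> A * \<epsilon> powr (2 - \<alpha>)" if "0 < \<epsilon>'" "\<epsilon>' \<le> \<epsilon>" "\<epsilon> \<le> 1" for \<epsilon> \<epsilon>'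
  proof (rule tendsto_upperbound)
    show "((\<lambda>R. \<bar>sym_int \<alpha> f x \<epsilon> R - sym_int \<alpha> f x \<epsilon>' R\<bar>) \<longlongrightarrow> \<bar>I \<epsilon> - I \<epsilon>'\<bar>) at_top"
      using that by (intro tendsto_intros I) auto
    show "eventually (\<lambda>R. \<bar>sym_int \<alpha> f x \<epsilon> R - sym_int \<alpha> f x \<epsilon>' R\<bar> \<le> A * \<epsilon> powr (2 - \<alpha>)) at_top"
      using eventually_ge_at_top[of \<epsilon>]
    proof eventually_elim
      case (elim R)
      then show ?case
        using sym_int_combine[of \<epsilon>' \<epsilon> R x] sym_int_near[of \<epsilon>' \<epsilon> x] that by (auto simp: A_def)
    qed
  qed auto
  have "\<exists>P. ((\<lambda>S. I (inverse S)) \<longlongrightarrow> P) at_top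
    \<and> (\<forall>S\<ge>1. \<bar>I (inverse S) - P\<bar> \<le> A * S powr - (2 - \<alpha>))"
  proof (rule cauchy_at_top_limit)
    show "((\<lambda>S. A * S powr - (2 - \<alpha>)) \<longlongrightarrow> 0) at_top"
      using tendsto_mult_left[OF powr0[of "2 - \<alpha>"], of A] alpha by simp
    show "\<bar>I (inverse R) - I (inverse S)\<bar> \<le> A * R powr - (2 - \<alpha>)" if "1 \<le> R" "R \<le> S" for R S
    proof -
      have "R powr - (2 - \<alpha>) = inverse R powr (2 - \<alpha>)"
        unfolding powr_minus inverse_powr ..
      then show ?thesis using Idiff[of "inverse S" "inverse R"] that by (simp add: le_imp_inverse_le inverse_le_1_iff)
    qed
  qed
  then obtain P where P: "((\<lambda>S. I (inverse S)) \<longlongrightarrow> P) at_top"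
    and P': "\<And>S. 1 \<le> S \<Longrightarrow> \<bar>I (inverse S) - P\<bar> \<le> A * S powr - (2 - \<alpha>)"
    by blast
  have P_lim: "(I \<longlongrightarrow> P) (at_right 0)"
    using P by (simp add: filterlim_at_right_to_top)
  have inner: "Lim at_top (\<lambda>R. LINT y:{y. \<epsilon> < \<bar>x - y\<bar> \<and> \<bar>x - y\<bar> < R}|lborel.
      (f y - f x) / (sgn (x - y) * \<bar>x - y\<bar> powr \<alpha>)) = I \<epsilon>" if "0 < \<epsilon>" "\<epsilon> \<le> 1" for \<epsilon>
  proof -
    have "(\<lambda>R. LINT y:{y. \<epsilon> < \<bar>x - y\<bar> \<and> \<bar>x - y\<bar> < R}|lborel. (f y - f x) / (sgn (x - y) * \<bar>x - y\<bar> powr \<alpha>))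
      = (\<lambda>R. sym_int \<alpha> f x \<epsilon> R)"
    proof
      fix R
      have "(f y - f x) / (sgn (x - y) * \<bar>x - y\<bar> powr \<alpha>) = (f y - f x) * (sgn (x - y) * \<bar>x - y\<bar> powr - \<alpha>)" for y
        by (auto simp: powr_minus field_simps sgn_if)
      then show "(LINT y:{y. \<epsilon> < \<bar>x - y\<bar> \<and> \<bar>x - y\<bar> < R}|lborel. (f y - f x) / (sgn (x - y) * \<bar>x - y\<bar> powr \<alpha>))
          = sym_int \<alpha> f x \<epsilon> R"
        using punctured_integral[of "\<lambda>y. f y - f x" \<epsilon> x R \<alpha>] that
        by (simp add: sym_int_def continuous_intros cont)
    qed
    then show ?thesis using I[OF that] by (intro tendsto_Lim) auto
  qed
  have "((\<lambda>\<epsilon>. Lim at_top (\<lambda>R. LINT y:{y. \<epsilon> < \<bar>x - y\<bar> \<and> \<bar>x - y\<bar> < R}|lborel.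
      (f y - f x) / (sgn (x - y) * \<bar>x - y\<bar> powr \<alpha>))) \<longlongrightarrow> P) (at_right 0)"
  proof (rule Lim_transform_eventually[OF P_lim])
    show "eventually (\<lambda>\<epsilon>. I \<epsilon> = Lim at_top (\<lambda>R. LINT y:{y. \<epsilon> < \<bar>x - y\<bar> \<and> \<bar>x - y\<bar> < R}|lborel.
      (f y - f x) / (sgn (x - y) * \<bar>x - y\<bar> powr \<alpha>))) (at_right 0)"
      using eventually_at_right_less[of 0] eventually_at_right_real[of 0 1]
      by (auto simp: inner elim!: eventually_mono)
  qed
  then have "pv x = P"
    unfolding pv_def pv_integral_def by (intro tendsto_Lim) auto
  moreover have "inverse \<epsilon> powr - (2 - \<alpha>) = \<epsilon> powr (2 - \<alpha>)"
    unfolding powr_minus inverse_powr by simp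
  ultimately show ?thesis
    using I'[OF eR] P'[of "inverse \<epsilon>"] eR by (auto simp: A_def one_le_inverse_iff)
qed

lemma sym_int_bound:
  assumes "0 < \<epsilon>" "\<epsilon> \<le> 1" "1 \<le> R"
  shows "\<bar>sym_int \<alpha> f x \<epsilon> R\<bar> \<le> 2 * M1 / (2 - \<alpha>) + 8 * M0"
  using assms sym_int_combine[of \<epsilon> 1 R x] sym_int_near[of \<epsilon> 1 x] sym_int_tail[of 1 R x] by auto

text \<open>The rate for the diagonal truncation \<epsilon> = 1 / (n + 1), R = n + 1, which replaces
  the double limit by a sequence.\<close>

definition error :: "nat \<Rightarrow> real" where
  "error n = 2 * M1 / (2 - \<alpha>) * real (Suc n) powr - (2 - \<alpha>) + 8 * M0 * real (Suc n) powr - \<alpha>"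

lemma pv_error: "\<bar>sym_int \<alpha> f x (1 / Suc n) (Suc n) - pv x\<bar> \<le> error n"
proof -
  have "(1 / real (Suc n)) powr (2 - \<alpha>) = real (Suc n) powr - (2 - \<alpha>)"
    by (simp only: powr_minus powr_divide powr_one_eq_one) (simp add: inverse_eq_divide)
  then show ?thesis
    using pv_approx[of "1 / Suc n" "Suc n" x] by (auto simp: error_def)
qed

lemma error_null: "error \<longlonglongrightarrow> 0"
proof -
  let ?e = "\<lambda>S. 2 * M1 / (2 - \<alpha>) * S powr - (2 - \<alpha>) + 8 * M0 * S powr - \<alpha>"
  have powr0: "((\<lambda>S. S powr - \<beta>) \<longlongrightarrow> 0) at_top" if "\<beta> > 0" for \<beta> :: real
    using that by (intro tendsto_neg_powr filterlim_ident) auto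
  have "(?e \<longlongrightarrow> 2 * M1 / (2 - \<alpha>) * 0 + 8 * M0 * 0) at_top"
    by (intro tendsto_intros powr0) (use alpha in auto)
  then show ?thesis unfolding error_def
    using filterlim_compose[OF _ filterlim_compose[OF filterlim_real_sequentially filterlim_Suc]] by auto
qed

lemma pv_seq: "(\<lambda>n. sym_int \<alpha> f x (1 / Suc n) (Suc n)) \<longlonglongrightarrow> pv x"
proof -
  have "(\<lambda>n. sym_int \<alpha> f x (1 / Suc n) (Suc n) - pv x) \<longlonglongrightarrow> 0"
    by (rule Lim_null_comparison[OF always_eventually error_null]) (use pv_error in auto)
  then show ?thesis using LIM_zero_iff by blast
qed

end

text \<open>Truncated integrals are linear and commute with translations, so the difference of those
  at x and x' is a truncated integral at 0 of a difference of translates, for which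
  \<open>sym_int_bound\<close> holds.\<close>

lemma pv_lipschitz:
  assumes f: "periodic_lipschitz \<alpha> M0 M1 f"
    and d: "periodic_lipschitz \<alpha> N0 N1 (\<lambda>y. f (y + x) - f (y + x'))"
  shows "\<bar>periodic_lipschitz.pv \<alpha> f x - periodic_lipschitz.pv \<alpha> f x'\<bar> \<le> 2 * N1 / (2 - \<alpha>) + 8 * N0"
proof (rule tendsto_upperbound)
  interpret f: periodic_lipschitz \<alpha> M0 M1 f by fact
  interpret d: periodic_lipschitz \<alpha> N0 N1 "\<lambda>y. f (y + x) - f (y + x')" by fact
  let ?S = "\<lambda>x n. sym_int \<alpha> f x (1 / Suc n) (Suc n)"
  show "(\<lambda>n. \<bar>?S x n - ?S x' n\<bar>) \<longlonglongrightarrow> \<bar>f.pv x - f.pv x'\<bar>"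
    by (intro tendsto_intros f.pv_seq)
  have io: "(\<lambda>z. (f (x - z) - f (x + z)) * z powr - \<alpha>) integrable_on {1 / Suc n..Suc n}" for x n
    by (intro integrable_continuous_interval f.integrand_cont) auto
  have "?S x n - ?S x' n = sym_int \<alpha> (\<lambda>y. f (y + x) - f (y + x')) 0 (1 / Suc n) (Suc n)" for n
    unfolding sym_int_def
    by (subst integral_diff[symmetric, OF io io]) (simp add: algebra_simps)
  then show "\<forall>\<^sub>F n in sequentially. \<bar>?S x n - ?S x' n\<bar> \<le> 2 * N1 / (2 - \<alpha>) + 8 * N0"
    using d.sym_int_bound[of "1 / Suc n" "Suc n" 0 for n] by (intro always_eventually) auto
qed auto

section \<open>Pair interactions\<close>

lemma sym_int_continuous:
  fixes \<rho> :: "real \<Rightarrow> 't::topological_space \<Rightarrow> real"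
  assumes cont: "continuous_on (UNIV \<times> A) (\<lambda>(x, t). \<rho> x t)" and "0 < \<epsilon>"
  shows "continuous_on (UNIV \<times> A) (\<lambda>(x, t). sym_int \<alpha> (\<lambda>y. \<rho> y t) x \<epsilon> R)"
proof -
  have c: "continuous_on ((UNIV \<times> A) \<times> cbox \<epsilon> R) (\<lambda>(p, z). (\<rho> (fst p - z) (snd p) - \<rho> (fst p + z) (snd p)) * z powr - \<alpha>)"
    unfolding split_def using \<open>0 < \<epsilon>\<close>
    by (intro continuous_intros
        continuous_on_compose2[OF cont, of _ "\<lambda>p. (fst (fst p) - snd p, snd (fst p))", simplified]
        continuous_on_compose2[OF cont, of _ "\<lambda>p. (fst (fst p) + snd p, snd (fst p))", simplified]) auto
  show ?thesis
    using integral_continuous_on_param[OF c] unfolding sym_int_def split_def by simp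
qed

text \<open>The truncated integrals converge uniformly in x and t, since \<open>error\<close>
  depends only on constants common to all t.\<close>

lemma pv_continuous:
  fixes \<rho> :: "real \<Rightarrow> 't::topological_space \<Rightarrow> real"
  assumes pl: "\<And>t. t \<in> A \<Longrightarrow> periodic_lipschitz \<alpha> M0 M1 (\<lambda>x. \<rho> x t)"
    and cont: "continuous_on (UNIV \<times> A) (\<lambda>(x, t). \<rho> x t)"
  shows "continuous_on (UNIV \<times> A) (\<lambda>(x, t). periodic_lipschitz.pv \<alpha> (\<lambda>x. \<rho> x t) x)"
proof (cases "A = {}")
  case False
  then obtain t0 where t0: "t0 \<in> A" by auto
  interpret t0: periodic_lipschitz \<alpha> M0 M1 "\<lambda>x. \<rho> x t0" by (rule pl[OF t0])
  let ?S = "\<lambda>n (x, t). sym_int \<alpha> (\<lambda>y. \<rho> y t) x (1 / Suc n) (Suc n)"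
  have "uniform_limit (UNIV \<times> A) ?S (\<lambda>(x, t). periodic_lipschitz.pv \<alpha> (\<lambda>x. \<rho> x t) x) sequentially"
  proof (rule uniform_limitI)
    fix e :: real assume "0 < e"
    with t0.error_null have "\<forall>\<^sub>F n in sequentially. dist (t0.error n) 0 < e"
      by (rule tendstoD)
    then show "\<forall>\<^sub>F n in sequentially. \<forall>p\<in>UNIV \<times> A.
        dist (?S n p) ((\<lambda>(x, t). periodic_lipschitz.pv \<alpha> (\<lambda>x. \<rho> x t) x) p) < e"
    proof eventually_elim
      case (elim n)
      show ?case
      proof safe
        fix x t assume "t \<in> A"
        from periodic_lipschitz.pv_error[OF pl[OF this], of x n] elim
        show "dist (sym_int \<alpha> (\<lambda>y. \<rho> y t) x (1 / Suc n) (Suc n)) (periodic_lipschitz.pv \<alpha> (\<lambda>x. \<rho> x t) x) < e"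
          by (auto simp: dist_real_def periodic_lipschitz.error_def[OF pl[OF \<open>t \<in> A\<close>]] t0.error_def)
      qed
    qed
  qed
  then show ?thesis
    by (rule uniform_limit_theorem[rotated])
      (auto intro!: always_eventually sym_int_continuous cont)
qed auto

section \<open>The truncated kernel and inequalities for pairs of points\<close>

definition trunc_kernel :: "real \<Rightarrow> real \<Rightarrow> real \<Rightarrow> real \<Rightarrow> real" where
  "trunc_kernel \<alpha> \<epsilon> R z = (if \<epsilon> < \<bar>z\<bar> \<and> \<bar>z\<bar> < R then sgn z * \<bar>z\<bar> powr - \<alpha> else 0)"

lemma trunc_kernel_measurable [measurable]: "trunc_kernel \<alpha> \<epsilon> R \<in> borel_measurable borel"
  unfolding trunc_kernel_def[abs_def] by measurable

lemma trunc_kernel_odd: "trunc_kernel \<alpha> \<epsilon> R (- z) = - trunc_kernel \<alpha> \<epsilon> R z"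
  by (simp add: trunc_kernel_def sgn_minus)

lemma trunc_kernel_bound:
  assumes "0 < \<epsilon>" "0 \<le> \<alpha>"
  shows "\<bar>trunc_kernel \<alpha> \<epsilon> R z\<bar> \<le> \<epsilon> powr - \<alpha>"
  using assms by (auto simp: trunc_kernel_def abs_mult abs_sgn_eq intro!: powr_mono2')

lemma trunc_kernel_pos:
  assumes "0 < z"
  shows "0 \<le> trunc_kernel \<alpha> \<epsilon> R z" "trunc_kernel \<alpha> \<epsilon> R z \<le> z powr - \<alpha>"
  using assms by (auto simp: trunc_kernel_def)

lemma powr_gap:
  fixes x y \<alpha> :: real
  assumes "0 < x" "x < y" "y \<le> 1" "0 < \<alpha>"
  shows "\<alpha> * x \<le> (y - x) powr - \<alpha> - y powr - \<alpha>"
proof -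
  have "\<exists>\<xi>>y - x. \<xi> < y \<and> y powr - \<alpha> - (y - x) powr - \<alpha> = (y - (y - x)) * (- \<alpha> * \<xi> powr (- \<alpha> - 1))"
    using assms by (intro MVT2) (auto intro!: derivative_eq_intros)
  then obtain \<xi> where \<xi>: "y - x < \<xi>" "\<xi> < y"
    "y powr - \<alpha> - (y - x) powr - \<alpha> = x * (- \<alpha> * \<xi> powr (- \<alpha> - 1))" by auto
  have "1 powr (- \<alpha> - 1) \<le> \<xi> powr (- \<alpha> - 1)"
    using \<xi> assms by (intro powr_mono2') auto
  then have "x * \<alpha> * 1 \<le> x * \<alpha> * \<xi> powr (- \<alpha> - 1)"
    using assms by (intro mult_left_mono) auto
  then show ?thesis using \<xi>(3) by (simp add: mult_ac)
qed

text \<open>The left side is (x^2 - y^2) * (x - y) powr (\<alpha> - 1). For \<alpha> \<ge> 1 the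
  last factor may be enlarged to x powr (\<alpha> - 1), and in the term with - y^2 it is then
  lowered to y powr (\<alpha> - 1).\<close>

lemma powr_Suc_diff_ge:
  fixes x y \<alpha> :: real
  assumes "0 < y" "y < x" "1 \<le> \<alpha>"
  shows "(x + y) * (x - y) powr \<alpha> \<le> x powr (1 + \<alpha>) - y powr (1 + \<alpha>)"
proof -
  have p: "z powr \<alpha> = z * z powr (\<alpha> - 1)" if "0 < z" for z :: real
    using that powr_mult_base[of z "\<alpha> - 1"] by simp
  have q: "z powr (1 + \<alpha>) = z\<^sup>2 * z powr (\<alpha> - 1)" if "0 < z" for z :: real
    using that powr_mult_base[of z \<alpha>] p[of z] by (simp add: power2_eq_square)
  have "(x + y) * (x - y) powr \<alpha> = (x\<^sup>2 - y\<^sup>2) * (x - y) powr (\<alpha> - 1)"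
  proof -
    have "(x - y) powr \<alpha> = (x - y) * (x - y) powr (\<alpha> - 1)" using assms p[of "x - y"] by simp
    then show ?thesis by (simp only: power2_eq_square square_diff_square_factored mult.assoc)
  qed
  also have "\<dots> \<le> (x\<^sup>2 - y\<^sup>2) * x powr (\<alpha> - 1)"
    using assms by (intro mult_left_mono powr_mono2) (auto simp: power_mono)
  also have "\<dots> = x powr (1 + \<alpha>) - y\<^sup>2 * x powr (\<alpha> - 1)"
    using assms by (simp add: q algebra_simps)
  also have "\<dots> \<le> x powr (1 + \<alpha>) - y\<^sup>2 * y powr (\<alpha> - 1)"
    using assms by (intro diff_left_mono mult_left_mono powr_mono2) auto
  finally show ?thesis using assms by (simp add: q)
qed

text \<open>The right side is the gain of a pair from its mutual interaction, positive because the
  point nearer to the vacuum has the larger weight; the left side is the loss from subtracting the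
  velocity at the vacuum. Clearing denominators leaves \<open>powr_Suc_diff_ge\<close>.\<close>

lemma kernel_pair_ineq:
  fixes x y \<alpha> :: real
  assumes "0 < y" "y < x" "1 \<le> \<alpha>"
  shows "x powr (- 1 - \<alpha>) * y powr - \<alpha> + y powr (- 1 - \<alpha>) * x powr - \<alpha>
     \<le> (y powr (- 1 - \<alpha>) - x powr (- 1 - \<alpha>)) * (x - y) powr - \<alpha>"
proof -
  define X where "X = x powr (1 + \<alpha>)"
  define Y where "Y = y powr (1 + \<alpha>)"
  define D where "D = (x - y) powr \<alpha>"
  have pos: "X > 0" "Y > 0" "D > 0" using assms by (auto simp: X_def Y_def D_def)
  have e: "x powr (- 1 - \<alpha>) = 1 / X" "y powr (- 1 - \<alpha>) = 1 / Y" "(x - y) powr - \<alpha> = 1 / D"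
    using powr_minus_divide[of x "1 + \<alpha>"] powr_minus_divide[of y "1 + \<alpha>"] powr_minus_divide[of "x - y" \<alpha>]
    by (auto simp: X_def Y_def D_def)
  have e': "x powr - \<alpha> = x / X" "y powr - \<alpha> = y / Y"
    using assms powr_mult_base[of x "- 1 - \<alpha>"] powr_mult_base[of y "- 1 - \<alpha>"] e by auto
  have "(x + y) * D \<le> X - Y"
    unfolding X_def Y_def D_def using powr_Suc_diff_ge[OF assms] by simp
  then have "x + y \<le> (X - Y) / D"
    using pos by (simp add: field_simps)
  then have "(x + y) / (X * Y) \<le> (X - Y) / D / (X * Y)"
    using pos by (intro divide_right_mono) auto
  also have "(X - Y) / D / (X * Y) = (1 / Y - 1 / X) * (1 / D)"
    using pos by (simp add: field_simps)
  also have "(x + y) / (X * Y) = 1 / X * (y / Y) + 1 / Y * (x / X)"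
    using pos by (simp add: field_simps)
  finally show ?thesis unfolding e e' .
qed

text \<open>The weight is \<open>x powr (- 1 - \<alpha>)\<close>, capped at scale \<open>\<delta>\<close>; for \<open>\<alpha> \<ge> 1\<close> this exponent makes the
  interaction of every pair of points above the cap favourable.\<close>

definition weight :: "real \<Rightarrow> real \<Rightarrow> real \<Rightarrow> real" where
  "weight \<alpha> \<delta> x = max x \<delta> powr (- 1 - \<alpha>)"

text \<open>What has to be added to make every pair favourable. The value 2 is charged to the
  farther point x when \<open>kernel_pair_ineq\<close> does not apply, that is for \<alpha> < 1 or
  for y below the cap; the value 1 pays for pairs whose mutual interaction is cut off at
  \<epsilon>.\<close>

definition pair_error :: "real \<Rightarrow> real \<Rightarrow> real \<Rightarrow> real \<Rightarrow> real \<Rightarrow> real" where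
  "pair_error \<alpha> \<delta> \<epsilon> x y = (if y < x \<and> (\<alpha> < 1 \<or> y < \<delta>) then 2 else 0) + (if \<bar>x - y\<bar> \<le> \<epsilon> then 1 else 0)"

lemma pair_error_nonneg: "0 \<le> pair_error \<alpha> \<delta> \<epsilon> x y"
  by (auto simp: pair_error_def)

lemma pair_interaction_aux:
  fixes x y \<alpha> \<delta> \<epsilon> R :: real
  assumes "0 < \<alpha>" "0 < \<delta>" "0 < \<epsilon>" "0 < y" "y \<le> x" "x < R"
  shows "0 \<le> weight \<alpha> \<delta> x * (trunc_kernel \<alpha> \<epsilon> R (y - x) - trunc_kernel \<alpha> \<epsilon> R y + y powr - \<alpha> * pair_error \<alpha> \<delta> \<epsilon> x y)
    + weight \<alpha> \<delta> y * (trunc_kernel \<alpha> \<epsilon> R (x - y) - trunc_kernel \<alpha> \<epsilon> R x + x powr - \<alpha> * pair_error \<alpha> \<delta> \<epsilon> y x)"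
proof -
  let ?w = "weight \<alpha> \<delta>" and ?K = "trunc_kernel \<alpha> \<epsilon> R" and ?e = "pair_error \<alpha> \<delta> \<epsilon>"
  have w0: "0 \<le> ?w z" for z by (simp add: weight_def)
  have x: "0 < x" using assms by simp
  have Kx: "?K x \<le> x powr - \<alpha>" and Ky: "?K y \<le> y powr - \<alpha>"
    using trunc_kernel_pos[of x] trunc_kernel_pos[of y] x assms by auto
  show ?thesis
  proof (cases "x - y \<le> \<epsilon>")
    case True
    then have K0: "?K (x - y) = 0" "?K (y - x) = 0" using assms by (auto simp: trunc_kernel_def)
    have e1: "?e x y \<ge> 1" "?e y x \<ge> 1" using True assms by (auto simp: pair_error_def)
    have "y powr - \<alpha> * 1 \<le> y powr - \<alpha> * ?e x y" "x powr - \<alpha> * 1 \<le> x powr - \<alpha> * ?e y x"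
      using e1 by (intro mult_left_mono; simp)+
    then have "0 \<le> 0 - ?K y + y powr - \<alpha> * ?e x y" "0 \<le> 0 - ?K x + x powr - \<alpha> * ?e y x"
      using Kx Ky by auto
    from add_nonneg_nonneg[OF mult_nonneg_nonneg[OF w0 this(1)] mult_nonneg_nonneg[OF w0 this(2)]]
    show ?thesis unfolding K0 .
  next
    case False
    then have d: "x - y > \<epsilon>" by simp
    have Kd: "?K (x - y) = (x - y) powr - \<alpha>" "?K (y - x) = - ((x - y) powr - \<alpha>)"
      using d assms by (auto simp: trunc_kernel_def)
    have wm: "?w x \<le> ?w y"
      unfolding weight_def using assms by (intro powr_mono2') auto
    have "?w x * y powr - \<alpha> + ?w y * x powr - \<alpha>
       \<le> (?w y - ?w x) * (x - y) powr - \<alpha> + ?w x * (y powr - \<alpha> * ?e x y)"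
    proof (cases "\<alpha> < 1 \<or> y < \<delta>")
      \<comment> \<open>One of the two units pays for x's own term with y powr - \<alpha>. The other
        pays for the term of y: its weight splits into the excess over the weight of x, covered by
        (x - y) powr - \<alpha> \<ge> x powr - \<alpha>, and the weight of x, covered by y powr -
        \<alpha> \<ge> x powr - \<alpha>.\<close>
      case True
      then have e2: "?e x y = 2" using d assms by (auto simp: pair_error_def)
      have "(?w y - ?w x) * x powr - \<alpha> \<le> (?w y - ?w x) * (x - y) powr - \<alpha>"
        using wm assms d by (intro mult_left_mono powr_mono2') auto
      moreover have "?w x * x powr - \<alpha> \<le> ?w x * y powr - \<alpha>"
        using assms w0 by (intro mult_left_mono powr_mono2') auto
      ultimately show ?thesis unfolding e2 by (simp add: algebra_simps)
    next
      case False
      then have "max x \<delta> = x" "max y \<delta> = y" using assms by auto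
      then have "?w x = x powr (- 1 - \<alpha>)" "?w y = y powr (- 1 - \<alpha>)"
        by (auto simp: weight_def)
      then have "?w x * y powr - \<alpha> + ?w y * x powr - \<alpha> \<le> (?w y - ?w x) * (x - y) powr - \<alpha>"
        using kernel_pair_ineq[of y x \<alpha>] False d assms by auto
      moreover have "0 \<le> ?w x * (y powr - \<alpha> * ?e x y)"
        using w0 pair_error_nonneg by simp
      ultimately show ?thesis by linarith
    qed
    moreover have "?w x * ?K y \<le> ?w x * y powr - \<alpha>" "?w y * ?K x \<le> ?w y * x powr - \<alpha>"
      using Kx Ky w0 by (intro mult_left_mono; simp)+
    moreover have "0 \<le> ?w y * (x powr - \<alpha> * ?e y x)" using w0 pair_error_nonneg by simp
    ultimately show ?thesis unfolding Kd by (simp add: algebra_simps)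
  qed
qed

lemma pair_interaction:
  fixes x y \<alpha> \<delta> \<epsilon> R :: real
  assumes "0 < \<alpha>" "0 < \<delta>" "0 < \<epsilon>" "0 < x" "0 < y" "x < R" "y < R"
  shows "0 \<le> weight \<alpha> \<delta> x * (trunc_kernel \<alpha> \<epsilon> R (y - x) - trunc_kernel \<alpha> \<epsilon> R y + y powr - \<alpha> * pair_error \<alpha> \<delta> \<epsilon> x y)
    + weight \<alpha> \<delta> y * (trunc_kernel \<alpha> \<epsilon> R (x - y) - trunc_kernel \<alpha> \<epsilon> R x + x powr - \<alpha> * pair_error \<alpha> \<delta> \<epsilon> y x)"
  using pair_interaction_aux[of \<alpha> \<delta> \<epsilon> y x R] pair_interaction_aux[of \<alpha> \<delta> \<epsilon> x y R] assms
  by (cases "y \<le> x") (auto simp: add.commute)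

text \<open>Exchanging the variables leaves the double integral unchanged, so it is half the
  integral of P x y + P y x.\<close>

lemma (in finite_measure) double_integral_nonneg:
  fixes P :: "'a \<Rightarrow> 'a \<Rightarrow> real"
  assumes meas: "(\<lambda>(x, y). P x y) \<in> borel_measurable (M \<Otimes>\<^sub>M M)"
    and bd: "\<And>x y. x \<in> space M \<Longrightarrow> y \<in> space M \<Longrightarrow> \<bar>P x y\<bar> \<le> B"
    and sym: "\<And>x y. x \<in> space M \<Longrightarrow> y \<in> space M \<Longrightarrow> 0 \<le> P x y + P y x"
  shows "integrable M (\<lambda>x. \<integral>y. P x y \<partial>M)" "0 \<le> (\<integral>x. \<integral>y. P x y \<partial>M \<partial>M)"
proof -
  interpret pair_sigma_finite M M ..
  interpret p: finite_measure "M \<Otimes>\<^sub>M M"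
    by (rule finite_measure_pair_measure) (unfold_locales)
  have int: "integrable (M \<Otimes>\<^sub>M M) (\<lambda>(x, y). P x y)"
    by (rule p.integrable_const_bound[where B = B]) (use meas bd in \<open>auto simp: space_pair_measure\<close>)
  have int': "integrable (M \<Otimes>\<^sub>M M) (\<lambda>(x, y). P y x)"
    using integrable_product_swap[OF int] by simp
  show "integrable M (\<lambda>x. \<integral>y. P x y \<partial>M)" using integrable_fst'[OF int] by simp
  have "0 \<le> (\<integral>p. (\<lambda>(x, y). P x y) p + (\<lambda>(x, y). P y x) p \<partial>(M \<Otimes>\<^sub>M M))"
    by (rule Bochner_Integration.integral_nonneg_AE) (use sym in \<open>auto intro!: AE_I2 simp: space_pair_measure\<close>)
  also have "\<dots> = (\<integral>p. (\<lambda>(x, y). P x y) p \<partial>(M \<Otimes>\<^sub>M M)) + (\<integral>p. (\<lambda>(x, y). P y x) p \<partial>(M \<Otimes>\<^sub>M M))"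
    by (rule Bochner_Integration.integral_add[OF int int'])
  also have "(\<integral>p. (\<lambda>(x, y). P y x) p \<partial>(M \<Otimes>\<^sub>M M)) = (\<integral>p. (\<lambda>(x, y). P x y) p \<partial>(M \<Otimes>\<^sub>M M))"
    using integral_product_swap[OF meas] by simp
  finally show "0 \<le> (\<integral>x. \<integral>y. P x y \<partial>M \<partial>M)"
    using integral_fst'[OF int] by simp
qed

section \<open>Interactions in a profile with a vacuum at the origin\<close>

lemma integrable_bounded_support:
  fixes h :: "real \<Rightarrow> real"
  assumes [measurable]: "h \<in> borel_measurable borel"
    and "\<And>y. \<bar>h y\<bar> \<le> B" "\<And>y. y \<notin> {p..q} \<Longrightarrow> h y = 0"
  shows "integrable lborel h"
proof (rule Bochner_Integration.integrable_bound)
  show "integrable lborel (\<lambda>y. B * indicat_real {p..q} y)"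
    by (intro integrable_mult_right integrable_real_indicator) (auto simp: emeasure_lborel_Icc_eq)
  show "AE y in lborel. norm (h y) \<le> norm (B * indicat_real {p..q} y)"
    using assms(2,3) by (intro AE_I2) (auto simp: indicator_def intro: order.trans[OF _ abs_ge_self])
qed simp

text \<open>M1 and C are kept apart: in the application M1 is uniform in time, whereas C comes from
  a second derivative bound on a finite time interval. C is allowed only in errors that vanish with
  \<epsilon> or \<delta>.\<close>

locale vacuum_profile = periodic_lipschitz +
  fixes C :: real
  assumes nonneg: "\<And>x. 0 \<le> f x"
    and zero: "f 0 = 0"
    and quad: "\<And>x. f x \<le> C * x\<^sup>2"
begin

lemma C: "0 \<le> C" using quad[of 1] nonneg[of 1] by auto

lemma f_meas [measurable]: "f \<in> borel_measurable borel"
  by (rule borel_measurable_continuous_onI[OF cont])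

lemma linear_bound: "f x \<le> M1 * \<bar>x\<bar>"
  using lip[of x 0] nonneg[of x] by (simp add: zero)

lemma quad_powr: "f y * y powr - \<alpha> \<le> C * y powr (2 - \<alpha>)" if "0 < y"
proof -
  have "f y * y powr - \<alpha> \<le> C * y\<^sup>2 * y powr - \<alpha>"
    using quad by (intro mult_right_mono) auto
  also have "\<dots> = C * y powr (2 - \<alpha>)"
    using that powr_add[of y 2 "-\<alpha>"] by (simp add: powr_numeral)
  finally show ?thesis .
qed

lemma quad_powr_le: "f y * y powr - \<alpha> \<le> C" if "0 < y" "y \<le> 1"
proof -
  have "y powr (2 - \<alpha>) \<le> 1" using that alpha by (intro powr_le1) auto
  then have "C * y powr (2 - \<alpha>) \<le> C * 1" using C by (intro mult_left_mono) auto
  with quad_powr[OF \<open>0 < y\<close>] show ?thesis by simp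
qed

abbreviation "K \<equiv> trunc_kernel \<alpha>"

text \<open>The untruncated kernel decreases on each half-line, so mass outside {0<..<a} pulls x
  towards 0; a rate \<alpha> * x is recorded only on {a..1}, where \<open>powr_gap\<close> supplies
  it. The indicators mark the strips where the cut at \<epsilon> may remove just one of the two
  kernel values. The cut at R does no harm: whenever it removes just one of them, the remaining term
  has the right sign.\<close>

lemma outer_interaction:
  assumes x: "0 < x" "x < a" "a \<le> 1/2" and eR: "0 < \<epsilon>" "\<epsilon> \<le> 1/3" "1 \<le> R"
    and y: "y \<notin> {0<..<a}"
  shows "\<alpha> * x * (f y * indicat_real {a..1} y) - 3 * C * (indicat_real {- \<epsilon>..0} y + indicat_real {a..a + \<epsilon>} y)
    \<le> f y * (K \<epsilon> R (y - x) - K \<epsilon> R y)" (is "?g - ?e \<le> _")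
proof -
  have e0: "?e \<ge> 0" using C by simp
  consider "y < - \<epsilon>" | "- \<epsilon> \<le> y" "y \<le> 0" | "a \<le> y" using y by force
  then show ?thesis
  proof cases
    case 1
    have "K \<epsilon> R y \<le> K \<epsilon> R (y - x)"
    proof (cases "\<bar>y - x\<bar> < R")
      case True
      then have "K \<epsilon> R y = - ((- y) powr - \<alpha>)" "K \<epsilon> R (y - x) = - ((x - y) powr - \<alpha>)"
        using 1 x eR by (auto simp: trunc_kernel_def)
      moreover have "(x - y) powr - \<alpha> \<le> (- y) powr - \<alpha>"
        using 1 x eR alpha by (intro powr_mono2') auto
      ultimately show ?thesis by simp
    next
      case False
      then show ?thesis using 1 eR by (auto simp: trunc_kernel_def)
    qed
    then have "0 \<le> f y * (K \<epsilon> R (y - x) - K \<epsilon> R y)" using nonneg by simp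
    moreover have "?g = 0" using 1 x eR by simp
    ultimately show ?thesis using e0 by linarith
  next
    case 2
    then have K0: "K \<epsilon> R y = 0" using eR by (simp add: trunc_kernel_def)
    \<comment> \<open>On this strip f is at most C * \<epsilon>^2, which offsets the largest
      possible kernel value \<epsilon> powr - \<alpha> \<le> \<epsilon> powr - 2.\<close>
    have "\<bar>f y * K \<epsilon> R (y - x)\<bar> \<le> C"
    proof -
      have "y\<^sup>2 \<le> \<epsilon>\<^sup>2" using 2 eR by (simp add: abs_le_square_iff[symmetric])
      then have "f y \<le> C * \<epsilon>\<^sup>2" using quad[of y] C mult_left_mono[of "y\<^sup>2" "\<epsilon>\<^sup>2" C] by simp
      moreover have "\<bar>K \<epsilon> R (y - x)\<bar> \<le> \<epsilon> powr - 2"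
        using trunc_kernel_bound[of \<epsilon> \<alpha> R "y - x"] powr_mono'[of "-2" "-\<alpha>" \<epsilon>] alpha eR by auto
      ultimately have "f y * \<bar>K \<epsilon> R (y - x)\<bar> \<le> C * \<epsilon>\<^sup>2 * \<epsilon> powr - 2"
        using C by (intro mult_mono) auto
      also have "\<epsilon> powr - 2 = 1 / \<epsilon>\<^sup>2" using eR by (simp add: powr_minus_divide powr_numeral)
      finally show ?thesis using eR nonneg[of y] by (simp add: abs_mult)
    qed
    then have "- C \<le> f y * (K \<epsilon> R (y - x) - K \<epsilon> R y)" unfolding K0 by simp
    moreover have "?g = 0" using 2 x by simp
    moreover have "?e \<ge> 3 * C" using 2 C by (simp add: distrib_left)
    ultimately show ?thesis using C by linarith
  next
    case 3
    have Ky: "K \<epsilon> R y \<le> y powr - \<alpha>" "0 \<le> K \<epsilon> R y" using trunc_kernel_pos[of y] 3 x by auto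
    consider "y - x \<le> \<epsilon>" | "\<epsilon> < y - x" "y \<le> 1" | "\<epsilon> < y - x" "1 < y" "y - x < R" | "R \<le> y - x" "1 < y"
      using eR by linarith
    then show ?thesis
    proof cases
      case 1
      have y1: "y \<le> 1" using 1 x eR by simp
      have "K \<epsilon> R (y - x) = 0" using 1 3 x by (simp add: trunc_kernel_def)
      moreover have "f y * K \<epsilon> R y \<le> C"
        using quad_powr_le[of y] mult_left_mono[OF Ky(1) nonneg[of y]] 3 x y1 by simp
      moreover have "?g \<le> C"
      proof -
        have "y\<^sup>2 \<le> 1" using y1 3 x by (simp add: power_le_one)
        then have "f y \<le> C" using quad[of y] C mult_left_mono[of "y\<^sup>2" 1 C] by simp
        moreover have "\<alpha> * x \<le> 2 * (1/2)" using alpha x by (intro mult_mono) auto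
        ultimately have "(\<alpha> * x) * f y \<le> 1 * C" using nonneg[of y] C by (intro mult_mono) auto
        then show ?thesis using 3 y1 by simp
      qed
      moreover have "?e \<ge> 3 * C" using 1 3 x C by simp
      ultimately show ?thesis using C by (simp add: right_diff_distrib)
    next
      case 2
      have "K \<epsilon> R (y - x) = (y - x) powr - \<alpha>" using 2 x eR by (simp add: trunc_kernel_def)
      then have "\<alpha> * x \<le> K \<epsilon> R (y - x) - K \<epsilon> R y"
        using powr_gap[of x y \<alpha>] Ky 2 3 x alpha by auto
      then have "f y * (\<alpha> * x) \<le> f y * (K \<epsilon> R (y - x) - K \<epsilon> R y)"
        using nonneg by (rule mult_left_mono)
      then show ?thesis using e0 2 3 by (simp add: mult_ac)
    next
      case 3
      have "K \<epsilon> R (y - x) = (y - x) powr - \<alpha>" using 3 eR by (simp add: trunc_kernel_def)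
      moreover have "y powr - \<alpha> \<le> (y - x) powr - \<alpha>" using 3 x alpha eR by (intro powr_mono2') auto
      ultimately have "0 \<le> f y * (K \<epsilon> R (y - x) - K \<epsilon> R y)" using nonneg Ky by simp
      then show ?thesis using e0 3 by simp
    next
      case 4
      then have "K \<epsilon> R (y - x) = 0" "K \<epsilon> R y = 0" using x by (auto simp: trunc_kernel_def)
      then show ?thesis using e0 4 by simp
    qed
  qed
qed

lemma sym_int_eq:
  assumes "0 < \<epsilon>" "0 \<le> R"
  shows "integrable lborel (\<lambda>y. f y * K \<epsilon> R (x - y))"
    "sym_int \<alpha> f x \<epsilon> R = (\<integral>y. f y * K \<epsilon> R (x - y) \<partial>lborel)"
proof -
  show "integrable lborel (\<lambda>y. f y * K \<epsilon> R (x - y))"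
  proof (rule integrable_bounded_support)
    show "(\<lambda>y. f y * K \<epsilon> R (x - y)) \<in> borel_measurable borel" by measurable
    show "\<bar>f y * K \<epsilon> R (x - y)\<bar> \<le> M0 * \<epsilon> powr - \<alpha>" for y
      unfolding abs_mult using bd trunc_kernel_bound[of \<epsilon> \<alpha>] assms alpha M0 by (intro mult_mono) auto
    show "f y * K \<epsilon> R (x - y) = 0" if "y \<notin> {x - R..x + R}" for y
      using that by (auto simp: trunc_kernel_def)
  qed
  show "sym_int \<alpha> f x \<epsilon> R = (\<integral>y. f y * K \<epsilon> R (x - y) \<partial>lborel)"
    unfolding punctured_integral[OF cont \<open>0 < \<epsilon>\<close>, symmetric] set_lebesgue_integral_def
    by (intro Bochner_Integration.integral_cong) (auto simp: trunc_kernel_def indicator_def)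
qed

text \<open>Bounds the interactions that the choice of exponent in the weight does not control.\<close>

definition loss :: "real \<Rightarrow> real \<Rightarrow> real" where
  "loss \<delta> x = (if \<alpha> < 1 then M1 * x powr (1 - \<alpha>) * x else C * \<delta> powr (2 - \<alpha>) * \<delta>)"

text \<open>The two parts of \<open>pair_error\<close> live on {0..D} and within \<epsilon> of x,
  where f y * y powr - \<alpha> is at most B and C; each contribution is a supremum times a length.
  B uses the linear bound for \<alpha> < 1 and the quadratic one otherwise, when only y < \<delta>
  contributes.\<close>

lemma inner_loss:
  assumes x: "0 < x" "x < a" "a \<le> 1/2" and "0 < \<delta>" "0 < \<epsilon>"
  shows "(\<integral>y. f y * (y powr - \<alpha> * pair_error \<alpha> \<delta> \<epsilon> x y) \<partial>restrict_space lborel {0<..<a})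
    \<le> 2 * loss \<delta> x + 2 * C * \<epsilon>"
proof -
  define B where "B = (if \<alpha> < 1 then M1 * x powr (1 - \<alpha>) else C * \<delta> powr (2 - \<alpha>))"
  define D where "D = (if \<alpha> < 1 then x else \<delta>)"
  have B: "0 \<le> B" using M1 C by (simp add: B_def)
  have BD: "B * D = loss \<delta> x" by (simp add: B_def D_def loss_def)
  have D: "0 < D" using assms by (simp add: D_def)
  let ?h = "\<lambda>y. f y * (y powr - \<alpha> * pair_error \<alpha> \<delta> \<epsilon> x y)"
  let ?u = "\<lambda>y. 2 * B * indicat_real {0..D} y + C * indicat_real {x - \<epsilon>..x + \<epsilon>} y"
  have pt: "indicat_real {0<..<a} y *\<^sub>R ?h y \<le> ?u y" for y
  proof (cases "y \<in> {0<..<a}")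
    case False then show ?thesis using B C by simp
  next
    case True
    then have y: "0 < y" "y < a" by auto
    have 1: "f y * y powr - \<alpha> * (if y < x \<and> (\<alpha> < 1 \<or> y < \<delta>) then 2 else 0) \<le> 2 * B * indicat_real {0..D} y"
    proof (cases "y < x \<and> (\<alpha> < 1 \<or> y < \<delta>)")
      case c: True
      have "f y * y powr - \<alpha> \<le> B"
      proof (cases "\<alpha> < 1")
        case True
        have "f y * y powr - \<alpha> \<le> M1 * y * y powr - \<alpha>"
          using linear_bound[of y] y by (intro mult_right_mono) auto
        also have "\<dots> = M1 * y powr (1 - \<alpha>)"
          using y powr_mult_base[of y "-\<alpha>"] by (simp add: mult.assoc)
        also have "\<dots> \<le> M1 * x powr (1 - \<alpha>)"
          using c y True M1 by (intro mult_left_mono powr_mono2) auto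
        finally show ?thesis using True by (simp add: B_def)
      next
        case False
        have "f y * y powr - \<alpha> \<le> C * y powr (2 - \<alpha>)" by (rule quad_powr[OF y(1)])
        also have "\<dots> \<le> C * \<delta> powr (2 - \<alpha>)"
          using c y False C alpha by (intro mult_left_mono powr_mono2) auto
        finally show ?thesis using False by (simp add: B_def)
      qed
      moreover have "y \<le> D" using c by (auto simp: D_def)
      ultimately show ?thesis using c y by simp
    qed (use B in auto)
    have 2: "f y * y powr - \<alpha> * (if \<bar>x - y\<bar> \<le> \<epsilon> then 1 else 0) \<le> C * indicat_real {x - \<epsilon>..x + \<epsilon>} y"
      using quad_powr_le[of y] y x C by (auto simp: indicator_def)
    have "?h y = f y * y powr - \<alpha> * (if y < x \<and> (\<alpha> < 1 \<or> y < \<delta>) then 2 else 0)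
        + f y * y powr - \<alpha> * (if \<bar>x - y\<bar> \<le> \<epsilon> then 1 else 0)"
      unfolding pair_error_def by (simp add: algebra_simps)
    then show ?thesis using 1 2 True by simp
  qed
  have iu: "integrable lborel ?u"
    by (intro Bochner_Integration.integrable_add integrable_mult_right integrable_real_indicator)
      (auto simp: emeasure_lborel_Icc_eq)
  have "(\<integral>y. ?h y \<partial>restrict_space lborel {0<..<a}) = (\<integral>y. indicat_real {0<..<a} y *\<^sub>R ?h y \<partial>lborel)"
    by (subst integral_restrict_space) auto
  also have "\<dots> \<le> (\<integral>y. ?u y \<partial>lborel)"
    using B C by (intro integral_mono_AE' iu AE_I2 pt) auto
  also have "\<dots> = 2 * B * D + C * (2 * \<epsilon>)"
    using D \<open>0 < \<epsilon>\<close> by (subst Bochner_Integration.integral_add) (auto simp: emeasure_lborel_Icc_eq)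
  finally show ?thesis using BD by simp
qed

text \<open>\<open>outer_interaction\<close> integrated over the line: two strips of width
  \<epsilon> give 6 * C * \<epsilon>, and the part inside {0<..<a} is left as it is for the
  symmetrization.\<close>

lemma outer_gain:
  assumes x: "0 < x" "x < a" "a \<le> 1/2" and eR: "0 < \<epsilon>" "\<epsilon> \<le> 1/3" "1 \<le> R"
  shows "\<alpha> * x * integral {a..1} f - 6 * C * \<epsilon>
     + (\<integral>y. f y * (K \<epsilon> R (y - x) - K \<epsilon> R y) \<partial>restrict_space lborel {0<..<a})
    \<le> sym_int \<alpha> f 0 \<epsilon> R - sym_int \<alpha> f x \<epsilon> R"
proof -
  let ?h = "\<lambda>y. f y * (K \<epsilon> R (y - x) - K \<epsilon> R y)"
  let ?g = "\<lambda>y. \<alpha> * x * (f y * indicat_real {a..1} y)"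
  let ?e = "\<lambda>y. 3 * C * (indicat_real {- \<epsilon>..0} y + indicat_real {a..a + \<epsilon>} y)"
  let ?i = "\<lambda>y. indicat_real {0<..<a} y *\<^sub>R ?h y"
  have sx: "integrable lborel (\<lambda>y. f y * K \<epsilon> R (x - y))" "integrable lborel (\<lambda>y. f y * K \<epsilon> R (0 - y))"
    using eR by (intro sym_int_eq(1); simp)+
  have h_eq: "?h = (\<lambda>y. f y * K \<epsilon> R (0 - y) - f y * K \<epsilon> R (x - y))"
    using trunc_kernel_odd[of \<alpha> \<epsilon> R "x - y" for y] trunc_kernel_odd[of \<alpha> \<epsilon> R y for y]
    by (auto simp: fun_eq_iff algebra_simps)
  have ih: "integrable lborel ?h" unfolding h_eq by (intro Bochner_Integration.integrable_diff sx)
  have ii: "integrable lborel ?i" by (rule integrable_mult_indicator[OF _ ih]) simp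
  have if': "set_integrable lborel {a..1} f"
    by (rule borel_integrable_atLeastAtMost'[OF cont])
  then have ig: "integrable lborel ?g"
    unfolding set_integrable_def by (simp add: mult.commute)
  have ie: "integrable lborel ?e"
    by (intro Bochner_Integration.integrable_add integrable_mult_right integrable_real_indicator)
      (auto simp: emeasure_lborel_Icc_eq)
  have pt: "?g y - ?e y + ?i y \<le> ?h y" for y
  proof (cases "y \<in> {0<..<a}")
    case True
    then have "?g y = 0" "?i y = ?h y" "?e y \<ge> 0" using C by auto
    then show ?thesis by linarith
  next
    case False
    then show ?thesis using outer_interaction[OF x eR False] by simp
  qed
  have "(\<integral>y. ?g y - ?e y + ?i y \<partial>lborel) \<le> (\<integral>y. ?h y \<partial>lborel)"
    by (intro integral_mono Bochner_Integration.integrable_add Bochner_Integration.integrable_diff ih ii ie ig pt)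
  moreover have "(\<integral>y. ?g y - ?e y + ?i y \<partial>lborel) = (\<integral>y. ?g y \<partial>lborel) - (\<integral>y. ?e y \<partial>lborel) + (\<integral>y. ?i y \<partial>lborel)"
    using ii ie ig by (simp only: Bochner_Integration.integral_add Bochner_Integration.integral_diff Bochner_Integration.integrable_diff)
  moreover have "(\<integral>y. ?g y \<partial>lborel) = \<alpha> * x * integral {a..1} f"
    using set_borel_integral_eq_integral(2)[OF if'] by (simp add: set_lebesgue_integral_def mult.commute)
  moreover have "(\<integral>y. ?e y \<partial>lborel) = 6 * C * \<epsilon>"
    using eR by (subst integral_mult_right_zero, subst Bochner_Integration.integral_add)
      (auto simp: emeasure_lborel_Icc_eq)
  moreover have "(\<integral>y. ?i y \<partial>lborel) = (\<integral>y. ?h y \<partial>restrict_space lborel {0<..<a})"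
    by (subst integral_restrict_space) auto
  moreover have "(\<integral>y. ?h y \<partial>lborel) = sym_int \<alpha> f 0 \<epsilon> R - sym_int \<alpha> f x \<epsilon> R"
    using sx eR by (simp only: h_eq sym_int_eq(2) Bochner_Integration.integral_diff less_imp_le)
  ultimately show ?thesis by linarith
qed

end

lemma integral_restrict_Ioo:
  fixes h :: "real \<Rightarrow> real"
  assumes "continuous_on {p..q} h"
  shows "integrable (restrict_space lborel {p<..<q}) h"
    "(\<integral>x. h x \<partial>restrict_space lborel {p<..<q}) = integral {p..q} h"
proof -
  have s: "set_integrable lborel {p<..<q} h"
    by (rule set_integrable_subset[OF borel_integrable_atLeastAtMost'[OF assms]]) auto
  then show "integrable (restrict_space lborel {p<..<q}) h"
    by (subst integrable_restrict_space) (auto simp: set_integrable_def)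
  have "(\<integral>x. h x \<partial>restrict_space lborel {p<..<q}) = (LINT x:{p<..<q}|lborel. h x)"
    by (subst integral_restrict_space) (auto simp: set_lebesgue_integral_def)
  then show "(\<integral>x. h x \<partial>restrict_space lborel {p<..<q}) = integral {p..q} h"
    using set_borel_integral_eq_integral(2)[OF s] by (simp add: integral_open_interval_real)
qed

lemma weight_cont: "0 < \<delta> \<Longrightarrow> continuous_on S (weight \<alpha> \<delta>)"
  unfolding weight_def[abs_def] by (intro continuous_intros) auto

lemma weight_measurable [measurable]: "weight \<alpha> \<delta> \<in> borel_measurable borel"
  unfolding weight_def[abs_def] by measurable

lemma weight_nonneg: "0 \<le> weight \<alpha> \<delta> x"
  by (simp add: weight_def)

lemma weight_le: "weight \<alpha> \<delta> x \<le> \<delta> powr (- 1 - \<alpha>)" if "0 < \<delta>" "0 < \<alpha>"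
  unfolding weight_def using that by (intro powr_mono2') auto

context periodic_lipschitz begin

lemma sym_int_cont: "0 < \<epsilon> \<Longrightarrow> continuous_on S (\<lambda>x. sym_int \<alpha> f x \<epsilon> R)"
proof -
  assume "0 < \<epsilon>"
  have "continuous_on (UNIV \<times> {0::real}) (\<lambda>(x, t). sym_int \<alpha> f x \<epsilon> R)"
    by (rule sym_int_continuous[where \<rho> = "\<lambda>x t. f x"])
      (use \<open>0 < \<epsilon>\<close> in \<open>auto simp: split_def intro!: continuous_on_compose2[OF cont] continuous_intros\<close>)
  from continuous_on_compose2[OF this, of S "\<lambda>x. (x, 0)"] show ?thesis
    by (simp add: image_subset_iff continuous_intros)
qed

lemma pv_cont: "continuous_on S pv"
proof -
  have "continuous_on (UNIV \<times> {0::real}) (\<lambda>(x, t). pv x)"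
    by (rule pv_continuous[where \<rho> = "\<lambda>x t. f x"])
      (use periodic_lipschitz_axioms in \<open>auto simp: split_def intro!: continuous_on_compose2[OF cont] continuous_intros\<close>)
  from continuous_on_compose2[OF this, of S "\<lambda>x. (x, 0)"] show ?thesis
    by (simp add: image_subset_iff continuous_intros)
qed

end

context vacuum_profile begin

lemma loss_cont: "continuous_on {0..a} (loss \<delta>)"
  by (cases "\<alpha> < 1") (auto simp: loss_def[abs_def] intro!: continuous_intros continuous_on_powr')

lemma truncated_lower_bound:
  assumes a: "0 < a" "a \<le> 1/2" and "0 < \<delta>" and eR: "0 < \<epsilon>" "\<epsilon> \<le> 1/3" "1 \<le> R"
  shows "integral {0..a} (\<lambda>x. f x * weight \<alpha> \<delta> x * (\<alpha> * x * integral {a..1} f - 8 * C * \<epsilon> - 2 * loss \<delta> x))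
    \<le> integral {0..a} (\<lambda>x. f x * weight \<alpha> \<delta> x * (sym_int \<alpha> f 0 \<epsilon> R - sym_int \<alpha> f x \<epsilon> R))"
proof -
  define \<mu> where "\<mu> = restrict_space lborel {0<..<a}"
  interpret finite_measure \<mu>
    using \<open>0 < a\<close> by (intro finite_measureI) (simp add: \<mu>_def emeasure_restrict_space space_restrict_space)
  have sp: "space \<mu> = {0<..<a}" by (simp add: \<mu>_def space_restrict_space)
  define g where "g x = f x * weight \<alpha> \<delta> x" for x
  have g0: "0 \<le> g x" for x using nonneg weight_nonneg by (simp add: g_def)
  define h1 where "h1 x y = f y * (K \<epsilon> R (y - x) - K \<epsilon> R y)" for x y
  define h2 where "h2 x y = f y * (y powr - \<alpha> * pair_error \<alpha> \<delta> \<epsilon> x y)" for x y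
  define P where "P x y = g x * (h1 x y + h2 x y)" for x y
  have b1: "\<bar>h1 x y\<bar> \<le> M0 * (2 * \<epsilon> powr - \<alpha>)" for x y
  proof -
    have "\<bar>K \<epsilon> R (y - x) - K \<epsilon> R y\<bar> \<le> 2 * \<epsilon> powr - \<alpha>"
      using trunc_kernel_bound[of \<epsilon> \<alpha> R "y - x"] trunc_kernel_bound[of \<epsilon> \<alpha> R y] alpha eR by simp
    then show ?thesis unfolding h1_def abs_mult using bd[of y] M0 by (intro mult_mono) auto
  qed
  have b2: "\<bar>h2 x y\<bar> \<le> C * 3" if "y \<in> space \<mu>" for x y
  proof -
    have "pair_error \<alpha> \<delta> \<epsilon> x y \<le> 3" by (simp add: pair_error_def)
    moreover have "f y * y powr - \<alpha> \<le> C" using quad_powr_le[of y] that a by (simp add: sp)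
    ultimately have "f y * y powr - \<alpha> * pair_error \<alpha> \<delta> \<epsilon> x y \<le> C * 3"
      using pair_error_nonneg C by (intro mult_mono) auto
    then show ?thesis using nonneg[of y] pair_error_nonneg[of \<alpha> \<delta> \<epsilon> x y] by (simp add: h2_def abs_mult mult_ac)
  qed
  have bg: "\<bar>g x\<bar> \<le> M0 * \<delta> powr (- 1 - \<alpha>)" for x
    unfolding g_def abs_mult
    using bd[of x] M0 weight_le[of \<delta> \<alpha> x] weight_nonneg[of \<alpha> \<delta> x] assms alpha by (intro mult_mono) auto
  have bP: "\<bar>P x y\<bar> \<le> M0 * \<delta> powr (- 1 - \<alpha>) * (M0 * (2 * \<epsilon> powr - \<alpha>) + C * 3)"
    if "x \<in> space \<mu>" "y \<in> space \<mu>" for x y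
    unfolding P_def abs_mult
    using bg[of x] b1[of x y] b2[OF that(2), of x] M0 by (intro mult_mono) auto
  have id_meas: "(\<lambda>x. x) \<in> \<mu> \<rightarrow>\<^sub>M borel"
    unfolding \<mu>_def by (rule measurable_restrict_space1) simp
  have m1: "(\<lambda>p. h1 (fst p) (snd p)) \<in> borel_measurable (borel \<Otimes>\<^sub>M borel)"
    unfolding h1_def by measurable
  have m2: "(\<lambda>p. h2 (fst p) (snd p)) \<in> borel_measurable (borel \<Otimes>\<^sub>M borel)"
    unfolding h2_def pair_error_def by measurable
  have m3: "(\<lambda>p. g (fst p)) \<in> borel_measurable (borel \<Otimes>\<^sub>M (borel :: real measure))"
    unfolding g_def by measurable
  have mP: "(\<lambda>p. P (fst p) (snd p)) \<in> borel_measurable (borel \<Otimes>\<^sub>M borel)"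
    unfolding P_def using m1 m2 m3 by measurable
  have "(\<lambda>p. (fst p, snd p)) \<in> \<mu> \<Otimes>\<^sub>M \<mu> \<rightarrow>\<^sub>M borel \<Otimes>\<^sub>M borel"
    by (intro measurable_Pair measurable_compose[OF measurable_fst id_meas] measurable_compose[OF measurable_snd id_meas])
  from measurable_compose[OF this mP]
  have mP': "(\<lambda>(x, y). P x y) \<in> borel_measurable (\<mu> \<Otimes>\<^sub>M \<mu>)" by (simp add: split_def)
  have sym: "0 \<le> P x y + P y x" if "x \<in> space \<mu>" "y \<in> space \<mu>" for x y
  proof -
    have "0 \<le> f x * f y * (weight \<alpha> \<delta> x * (K \<epsilon> R (y - x) - K \<epsilon> R y + y powr - \<alpha> * pair_error \<alpha> \<delta> \<epsilon> x y)
      + weight \<alpha> \<delta> y * (K \<epsilon> R (x - y) - K \<epsilon> R x + x powr - \<alpha> * pair_error \<alpha> \<delta> \<epsilon> y x))"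
      using that a eR \<open>0 < \<delta>\<close> alpha nonneg
      by (intro mult_nonneg_nonneg pair_interaction) (auto simp: sp)
    also have "\<dots> = P x y + P y x" unfolding P_def g_def h1_def h2_def by algebra
    finally show ?thesis .
  qed
  note dbl = double_integral_nonneg[OF mP' bP sym]
  have int1: "integrable \<mu> (h1 x)" for x
  proof (rule integrable_const_bound[where B = "M0 * (2 * \<epsilon> powr - \<alpha>)"])
    show "h1 x \<in> borel_measurable \<mu>"
      unfolding h1_def[abs_def] \<mu>_def by (intro measurable_restrict_space1) measurable
  qed (use b1 in auto)
  have int2: "integrable \<mu> (h2 x)" for x
  proof (rule integrable_const_bound[where B = "C * 3"])
    show "h2 x \<in> borel_measurable \<mu>"
      unfolding h2_def[abs_def] pair_error_def \<mu>_def by (intro measurable_restrict_space1) measurable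
  qed (use b2 in \<open>auto intro!: AE_I2\<close>)
  have split: "(\<integral>y. P x y \<partial>\<mu>) = g x * ((\<integral>y. h1 x y \<partial>\<mu>) + (\<integral>y. h2 x y \<partial>\<mu>))" for x
    unfolding P_def using int1 int2 by simp
  let ?l = "\<lambda>x. g x * (\<alpha> * x * integral {a..1} f - 8 * C * \<epsilon> - 2 * loss \<delta> x)"
  let ?r = "\<lambda>x. g x * (sym_int \<alpha> f 0 \<epsilon> R - sym_int \<alpha> f x \<epsilon> R)"
  have pt: "?l x + (\<integral>y. P x y \<partial>\<mu>) \<le> ?r x" if "x \<in> space \<mu>" for x
  proof -
    have "\<alpha> * x * integral {a..1} f - 8 * C * \<epsilon> - 2 * loss \<delta> x + ((\<integral>y. h1 x y \<partial>\<mu>) + (\<integral>y. h2 x y \<partial>\<mu>))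
        \<le> sym_int \<alpha> f 0 \<epsilon> R - sym_int \<alpha> f x \<epsilon> R"
      using outer_gain[of x a \<epsilon> R] inner_loss[of x a \<delta> \<epsilon>] that assms
      by (simp add: sp h1_def h2_def \<mu>_def)
    from mult_left_mono[OF this g0[of x]] show ?thesis unfolding split by (simp add: algebra_simps)
  qed
  have cg: "continuous_on {0..a} g"
    unfolding g_def[abs_def] by (intro continuous_intros cont weight_cont \<open>0 < \<delta>\<close>)
  have cl: "continuous_on {0..a} ?l"
    by (intro continuous_intros cg loss_cont)
  have cr: "continuous_on {0..a} ?r"
    by (intro continuous_intros cg sym_int_cont eR)
  note il = integral_restrict_Ioo[OF cl, folded \<mu>_def] and ir = integral_restrict_Ioo[OF cr, folded \<mu>_def]
  have "(\<integral>x. ?l x \<partial>\<mu>) \<le> (\<integral>x. ?l x \<partial>\<mu>) + (\<integral>x. \<integral>y. P x y \<partial>\<mu> \<partial>\<mu>)" using dbl(2) by simp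
  also have "\<dots> = (\<integral>x. ?l x + (\<integral>y. P x y \<partial>\<mu>) \<partial>\<mu>)"
    by (rule Bochner_Integration.integral_add[symmetric]) (use il(1) dbl(1) in auto)
  also have "\<dots> \<le> (\<integral>x. ?r x \<partial>\<mu>)"
    by (intro integral_mono Bochner_Integration.integrable_add) (use il(1) ir(1) dbl(1) pt in auto)
  finally show ?thesis using il(2) ir(2) by (simp add: g_def)
qed

lemma inflow_lower_bound:
  assumes a: "0 < a" "a \<le> 1/2" and "0 < \<delta>"
  shows "integral {0..a} (\<lambda>x. f x * weight \<alpha> \<delta> x * (\<alpha> * x * integral {a..1} f - 2 * loss \<delta> x))
    \<le> integral {0..a} (\<lambda>x. f x * weight \<alpha> \<delta> x * (pv 0 - pv x))"
proof -
  define g where "g x = f x * weight \<alpha> \<delta> x" for x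
  have g0: "0 \<le> g x" for x using nonneg weight_nonneg by (simp add: g_def)
  have cg: "continuous_on {0..a} g"
    unfolding g_def[abs_def] by (intro continuous_intros cont weight_cont \<open>0 < \<delta>\<close>)
  let ?l = "\<lambda>x. g x * (\<alpha> * x * integral {a..1} f - 2 * loss \<delta> x)"
  let ?r = "\<lambda>x. g x * (pv 0 - pv x)"
  let ?c = "\<lambda>n. 8 * C * (1 / Suc n) + 2 * error n"
  have "?c \<longlonglongrightarrow> 8 * C * 0 + 2 * 0"
    by (intro tendsto_intros error_null) (rule lim_1_over_real_power[of 1, simplified] | use LIMSEQ_inverse_real_of_nat in \<open>simp add: inverse_eq_divide\<close>)+
  then have lim: "(\<lambda>n. integral {0..a} ?l - ?c n * integral {0..a} g) \<longlonglongrightarrow> integral {0..a} ?l - 0 * integral {0..a} g"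
    by (intro tendsto_intros) simp
  \<comment> \<open>n \<ge> 2 makes the truncation length 1 / (n + 1) at most 1/3.\<close>
  have "integral {0..a} ?l - ?c n * integral {0..a} g \<le> integral {0..a} ?r" if "n \<ge> 2" for n
  proof -
    let ?\<epsilon> = "1 / real (Suc n)" and ?R = "real (Suc n)"
    let ?s = "\<lambda>x. g x * (sym_int \<alpha> f 0 ?\<epsilon> ?R - sym_int \<alpha> f x ?\<epsilon> ?R)"
    have cs: "continuous_on {0..a} ?s" by (intro continuous_intros cg sym_int_cont) simp
    have cr: "continuous_on {0..a} ?r" by (intro continuous_intros cg pv_cont)
    have cl: "continuous_on {0..a} ?l" by (intro continuous_intros cg loss_cont)
    have io: "h integrable_on {0..a}" if "continuous_on {0..a} h" for h :: "real \<Rightarrow> real"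
      using that by (rule integrable_continuous_interval)
    have "integral {0..a} ?l - 8 * C * ?\<epsilon> * integral {0..a} g
        = integral {0..a} (\<lambda>x. ?l x - 8 * C * ?\<epsilon> * g x)"
      using io[OF cl] io[OF continuous_on_mult_left[OF cg]] by (subst integral_diff) auto
    also have "\<dots> = integral {0..a} (\<lambda>x. g x * (\<alpha> * x * integral {a..1} f - 8 * C * ?\<epsilon> - 2 * loss \<delta> x))"
      by (intro integral_cong) (simp add: algebra_simps)
    also have "\<dots> \<le> integral {0..a} ?s"
      using truncated_lower_bound[OF a \<open>0 < \<delta>\<close>, of ?\<epsilon> ?R] that by (simp add: g_def field_simps)
    also have "\<dots> \<le> integral {0..a} (\<lambda>x. ?r x + 2 * error n * g x)"
    proof (rule integral_le)
      show "(\<lambda>x. ?r x + 2 * error n * g x) integrable_on {0..a}"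
        by (intro io continuous_intros cg cr)
      fix x
      have "sym_int \<alpha> f 0 ?\<epsilon> ?R - sym_int \<alpha> f x ?\<epsilon> ?R \<le> pv 0 - pv x + 2 * error n"
        using pv_error[of 0 n] pv_error[of x n] by auto
      from mult_left_mono[OF this g0[of x]] show "?s x \<le> ?r x + 2 * error n * g x"
        by (simp add: algebra_simps)
    qed (rule io[OF cs])
    also have "\<dots> = integral {0..a} ?r + 2 * error n * integral {0..a} g"
      using io[OF cr] io[OF continuous_on_mult_left[OF cg]] by (subst integral_add) auto
    finally show ?thesis by (simp add: algebra_simps)
  qed
  then have "integral {0..a} ?l - 0 * integral {0..a} g \<le> integral {0..a} ?r"
    by (intro tendsto_upperbound[OF lim]) (auto simp: eventually_sequentially)
  then show ?thesis by (simp add: g_def)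
qed

end

text \<open>The test function \<open>\<phi>\<close> of the overview. Integrating up to a makes it
  vanish at a, which removes the boundary term there; the capped weight keeps it bounded at
  0.\<close>

definition potential :: "real \<Rightarrow> real \<Rightarrow> real \<Rightarrow> real \<Rightarrow> real" where
  "potential \<alpha> \<delta> a x = integral {x..a} (weight \<alpha> \<delta>)"

lemma weight_integrable: "0 < \<delta> \<Longrightarrow> weight \<alpha> \<delta> integrable_on {p..q}"
  by (intro integrable_continuous_interval weight_cont)

lemma potential_deriv:
  assumes "0 < \<delta>" "x \<in> {p..a}"
  shows "(potential \<alpha> \<delta> a has_real_derivative - weight \<alpha> \<delta> x) (at x within {p..a})"
  unfolding potential_def[abs_def]
  by (rule integral_has_real_derivative') (use assms weight_cont in auto)

lemma potential_cont: "0 < \<delta> \<Longrightarrow> continuous_on {p..a} (potential \<alpha> \<delta> a)"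
  by (meson DERIV_continuous continuous_on_eq_continuous_within potential_deriv)

lemma potential_nonneg: "0 < \<delta> \<Longrightarrow> 0 \<le> potential \<alpha> \<delta> a x"
  unfolding potential_def by (intro Henstock_Kurzweil_Integration.integral_nonneg weight_integrable weight_nonneg)

text \<open>Lowering the cap raises the energy, so the initial energy has a lower bound independent
  of \<delta>.\<close>

lemma potential_antimono:
  assumes "0 < \<delta>" "\<delta> \<le> \<delta>'" "0 < \<alpha>"
  shows "potential \<alpha> \<delta>' a x \<le> potential \<alpha> \<delta> a x"
  unfolding potential_def using assms
  by (intro integral_le weight_integrable) (auto simp: weight_def intro!: powr_mono2')

lemma powr_integral:
  fixes x a \<alpha> :: real
  assumes "0 < x" "x \<le> a" "0 < \<alpha>"
  shows "((\<lambda>z. z powr (- 1 - \<alpha>)) has_integral (x powr - \<alpha> / \<alpha> - a powr - \<alpha> / \<alpha>)) {x..a}"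
proof -
  define F where "F z = - (z powr - \<alpha> / \<alpha>)" for z :: real
  have e: "- 1 - \<alpha> = - \<alpha> - 1" by simp
  have "((\<lambda>z. z powr (- 1 - \<alpha>)) has_integral (F a - F x)) {x..a}"
    unfolding e by (rule fundamental_theorem_of_calculus)
      (use assms in \<open>auto simp: F_def[abs_def] simp flip: has_real_derivative_iff_has_vector_derivative intro!: derivative_eq_intros\<close>)
  then show ?thesis by (simp add: F_def)
qed

lemma potential_le_powr:
  assumes "0 < \<delta>" "0 < x" "x \<le> a" "0 < \<alpha>"
  shows "potential \<alpha> \<delta> a x \<le> x powr - \<alpha> / \<alpha>"
proof -
  have "potential \<alpha> \<delta> a x \<le> integral {x..a} (\<lambda>z. z powr (- 1 - \<alpha>))"
    unfolding potential_def using assms powr_integral[of x a \<alpha>]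
    by (intro integral_le weight_integrable) (auto simp: weight_def integrable_on_def intro!: powr_mono2')
  also have "\<dots> = x powr - \<alpha> / \<alpha> - a powr - \<alpha> / \<alpha>"
    using assms by (intro integral_unique powr_integral)
  also have "\<dots> \<le> x powr - \<alpha> / \<alpha>" using assms by simp
  finally show ?thesis .
qed

text \<open>The flat part of the weight contributes at most \<delta> powr - \<alpha>, the power part
  beyond \<delta> at most \<delta> powr - \<alpha> / \<alpha>.\<close>

lemma potential_le_cap:
  assumes "0 < \<delta>" "0 \<le> x" "x \<le> \<delta>" "\<delta> \<le> a" "0 < \<alpha>"
  shows "potential \<alpha> \<delta> a x \<le> (1 + 1 / \<alpha>) * \<delta> powr - \<alpha>"
proof -
  have "potential \<alpha> \<delta> a x = integral {x..\<delta>} (weight \<alpha> \<delta>) + potential \<alpha> \<delta> a \<delta>"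
    unfolding potential_def using assms
    by (intro Henstock_Kurzweil_Integration.integral_combine[symmetric] weight_integrable) auto
  also have "integral {x..\<delta>} (weight \<alpha> \<delta>) \<le> \<delta> powr (- 1 - \<alpha>) * (\<delta> - x)"
    using integral_bound[of x \<delta> "weight \<alpha> \<delta>" "\<delta> powr (- 1 - \<alpha>)"] assms weight_cont weight_le[of \<delta> \<alpha>]
    by (auto simp: weight_nonneg)
  also have "\<dots> \<le> \<delta> powr (- 1 - \<alpha>) * \<delta>" using assms by (intro mult_left_mono) auto
  also have "\<dots> = \<delta> powr - \<alpha>" using assms powr_mult_base[of \<delta> "- 1 - \<alpha>"] by (simp add: mult.commute)
  also have "potential \<alpha> \<delta> a \<delta> \<le> \<delta> powr - \<alpha> / \<alpha>" using assms by (intro potential_le_powr) auto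
  finally show ?thesis by (simp add: algebra_simps)
qed

text \<open>Half of the gain g * (\<alpha> * x * m) is spent on the loss L; the first assumption
  converts the other half into the energy density G.\<close>

lemma inflow_combine:
  fixes \<alpha> m G g x k e I L :: real
  assumes "\<alpha> * G \<le> g * x + k" "0 \<le> \<alpha> * m" "g * (\<alpha> * x * m) \<le> g * (\<alpha> * x * I)"
    "g * (2 * L) \<le> g * (\<alpha> * x * m / 2) + e"
  shows "\<alpha>\<^sup>2 * m / 2 * G - (\<alpha> * m / 2 * k + e) \<le> g * (\<alpha> * x * I - 2 * L)"
proof -
  have "\<alpha> * m / 2 * (\<alpha> * G) \<le> \<alpha> * m / 2 * (g * x + k)"
    using assms(1,2) by (intro mult_left_mono) auto
  then have "\<alpha>\<^sup>2 * m / 2 * G - \<alpha> * m / 2 * k \<le> g * (\<alpha> * x * m) / 2"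
    by (simp add: power2_eq_square algebra_simps)
  moreover have "g * (2 * L) \<le> g * (\<alpha> * x * m) / 2 + e" using assms(4) by simp
  ultimately show ?thesis using assms(3) unfolding right_diff_distrib by linarith
qed

section \<open>Inflow against potential energy\<close>

context vacuum_profile begin

lemma density_weight_le: "f x * weight \<alpha> \<delta> x \<le> C * \<delta> powr (1 - \<alpha>)" if "0 < \<delta>" "0 \<le> x" "1 \<le> \<alpha>"
proof -
  let ?m = "max x \<delta>"
  have m: "0 < ?m" "\<delta> \<le> ?m" using that by auto
  have "f x \<le> C * ?m\<^sup>2"
    using quad[of x] C that mult_left_mono[of "x\<^sup>2" "?m\<^sup>2" C] by (auto simp: power_mono)
  then have "f x * weight \<alpha> \<delta> x \<le> C * ?m\<^sup>2 * ?m powr (- 1 - \<alpha>)"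
    unfolding weight_def by (intro mult_right_mono) auto
  also have "\<dots> = C * ?m powr (1 - \<alpha>)"
    using m powr_add[of ?m 2 "- 1 - \<alpha>"] by (simp add: powr_numeral)
  also have "\<dots> \<le> C * \<delta> powr (1 - \<alpha>)"
    using m that C by (intro mult_left_mono powr_mono2') auto
  finally show ?thesis .
qed

text \<open>Above the cap the power law makes \<alpha> times the potential at most x times the
  weight; this turns an inflow rate proportional to x into growth of the energy itself. Below the
  cap f x \<le> C * \<delta>^2 makes the contribution small.\<close>

lemma density_potential_le:
  assumes "0 < \<delta>" "\<delta> \<le> a" "0 \<le> x" "x \<le> a"
  shows "\<alpha> * (f x * potential \<alpha> \<delta> a x) \<le> f x * weight \<alpha> \<delta> x * x + C * (\<alpha> + 1) * \<delta> powr (2 - \<alpha>)"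
proof (cases "x \<le> \<delta>")
  case True
  have "x\<^sup>2 \<le> \<delta>\<^sup>2" using True assms by (simp add: power_mono)
  then have "f x \<le> C * \<delta>\<^sup>2" using quad[of x] C mult_left_mono[of "x\<^sup>2" "\<delta>\<^sup>2" C] by simp
  then have "f x * potential \<alpha> \<delta> a x \<le> C * \<delta>\<^sup>2 * ((1 + 1 / \<alpha>) * \<delta> powr - \<alpha>)"
    using potential_le_cap[of \<delta> x a \<alpha>] assms alpha True C
    by (intro mult_mono potential_nonneg) auto
  also have "\<dots> = C * (1 + 1 / \<alpha>) * \<delta> powr (2 - \<alpha>)"
    using assms powr_add[of \<delta> 2 "-\<alpha>"] by (simp add: powr_numeral)
  finally have "\<alpha> * (f x * potential \<alpha> \<delta> a x) \<le> \<alpha> * (C * (1 + 1 / \<alpha>) * \<delta> powr (2 - \<alpha>))"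
    using alpha by (intro mult_left_mono) auto
  also have "\<dots> = C * (\<alpha> + 1) * \<delta> powr (2 - \<alpha>)" using alpha by (simp add: field_simps)
  moreover have "0 \<le> f x * weight \<alpha> \<delta> x * x" using assms nonneg weight_nonneg by simp
  ultimately show ?thesis by linarith
next
  case False
  then have x: "0 < x" "max x \<delta> = x" using assms by auto
  have "\<alpha> * potential \<alpha> \<delta> a x \<le> x powr - \<alpha>"
    using potential_le_powr[of \<delta> x a \<alpha>] assms alpha x by (simp add: field_simps)
  also have "\<dots> = weight \<alpha> \<delta> x * x"
    unfolding weight_def x(2) using powr_mult_base[of x "- 1 - \<alpha>"] x(1) by (simp add: mult.commute)
  finally have "f x * (\<alpha> * potential \<alpha> \<delta> a x) \<le> f x * (weight \<alpha> \<delta> x * x)"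
    using nonneg by (rule mult_left_mono)
  moreover have "0 \<le> C * (\<alpha> + 1) * \<delta> powr (2 - \<alpha>)" using C alpha by simp
  ultimately show ?thesis by (simp add: mult_ac)
qed

text \<open>For \<alpha> < 1 the loss is at most M1 * a powr (1 - \<alpha>) * x, a fraction of the
  gain by \<open>small\<close>. For \<alpha> \<ge> 1 it stems from pairs with a point below the cap;
  the exponents 1 - \<alpha> of the weighted density, 2 - \<alpha> of the interaction and 1 of the
  length add up to 4 - 2 * \<alpha>.\<close>

lemma inflow_ge_potential:
  assumes a: "0 < a" "a \<le> 1/2" and \<delta>: "0 < \<delta>" "\<delta> \<le> a"
    and m: "0 \<le> m" "m \<le> integral {a..1} f"
    and small: "\<alpha> < 1 \<Longrightarrow> 4 * M1 * a powr (1 - \<alpha>) \<le> \<alpha> * m"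
  shows "\<alpha>\<^sup>2 * m / 2 * integral {0..a} (\<lambda>x. f x * potential \<alpha> \<delta> a x)
      - (\<alpha> * m / 2 * (C * (\<alpha> + 1) * \<delta> powr (2 - \<alpha>)) + 2 * C\<^sup>2 * \<delta> powr (4 - 2 * \<alpha>)) * a
    \<le> integral {0..a} (\<lambda>x. f x * weight \<alpha> \<delta> x * (pv 0 - pv x))"
proof -
  let ?G = "\<lambda>x. f x * potential \<alpha> \<delta> a x"
  let ?E = "\<alpha> * m / 2 * (C * (\<alpha> + 1) * \<delta> powr (2 - \<alpha>)) + 2 * C\<^sup>2 * \<delta> powr (4 - 2 * \<alpha>)"
  let ?l = "\<lambda>x. f x * weight \<alpha> \<delta> x * (\<alpha> * x * integral {a..1} f - 2 * loss \<delta> x)"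
  have cG: "continuous_on {0..a} ?G" by (intro continuous_intros cont potential_cont \<delta>)
  have cl: "continuous_on {0..a} ?l" by (intro continuous_intros cont loss_cont weight_cont \<delta>)
  have pt: "\<alpha>\<^sup>2 * m / 2 * ?G x - ?E \<le> ?l x" if x: "x \<in> {0..a}" for x
  proof -
    let ?g = "f x * weight \<alpha> \<delta> x"
    have g0: "0 \<le> ?g" using nonneg weight_nonneg by simp
    have mm: "?g * (\<alpha> * x * m) \<le> ?g * (\<alpha> * x * integral {a..1} f)"
      using g0 m x alpha by (intro mult_left_mono) auto
    have loss: "?g * (2 * loss \<delta> x) \<le> ?g * (\<alpha> * x * m / 2) + 2 * C\<^sup>2 * \<delta> powr (4 - 2 * \<alpha>)"
    proof (cases "\<alpha> < 1")
      case True
      have "4 * M1 * x powr (1 - \<alpha>) \<le> 4 * M1 * a powr (1 - \<alpha>)"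
        using x True M1 by (intro mult_left_mono powr_mono2) auto
      also have "\<dots> \<le> \<alpha> * m" by (rule small[OF True])
      finally have "x * (4 * M1 * x powr (1 - \<alpha>)) \<le> x * (\<alpha> * m)" using x by (intro mult_left_mono) auto
      then have "2 * loss \<delta> x \<le> \<alpha> * x * m / 2" using True by (simp add: loss_def mult_ac)
      have "0 \<le> 2 * C\<^sup>2 * \<delta> powr (4 - 2 * \<alpha>)" by simp
      with mult_left_mono[OF \<open>2 * loss \<delta> x \<le> \<alpha> * x * m / 2\<close> g0] show ?thesis by linarith
    next
      case False
      have "?g * (2 * loss \<delta> x) \<le> C * \<delta> powr (1 - \<alpha>) * (2 * (C * \<delta> powr (2 - \<alpha>) * \<delta>))"
        using False C \<delta> x g0
        by (intro mult_mono[where a = "f x * weight \<alpha> \<delta> x"] density_weight_le) (auto simp: loss_def)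
      also have "\<dots> = 2 * C\<^sup>2 * (\<delta> powr (1 - \<alpha>) * (\<delta> powr (2 - \<alpha>) * \<delta> powr 1))"
        using \<delta> by (simp add: power2_eq_square)
      also have "\<dots> = 2 * C\<^sup>2 * \<delta> powr (4 - 2 * \<alpha>)"
        by (simp only: powr_add[symmetric]) simp
      finally show ?thesis using g0 x m alpha by (simp add: add_increasing)
    qed
    have "\<alpha> * ?G x \<le> ?g * x + C * (\<alpha> + 1) * \<delta> powr (2 - \<alpha>)"
      using density_potential_le[of \<delta> a x] \<delta> x by simp
    moreover have "0 \<le> \<alpha> * m" using m alpha by simp
    ultimately show ?thesis using mm loss by (rule inflow_combine)
  qed
  have "\<alpha>\<^sup>2 * m / 2 * integral {0..a} ?G - ?E * a = integral {0..a} (\<lambda>x. \<alpha>\<^sup>2 * m / 2 * ?G x - ?E)"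
    using a integrable_continuous_interval[OF continuous_on_mult_left[OF cG]]
    by (subst integral_diff) (simp_all add: integrable_const_ivl)
  also have "\<dots> \<le> integral {0..a} ?l"
    by (rule integral_le[OF integrable_continuous_interval integrable_continuous_interval[OF cl] pt])
      (rule continuous_on_diff[OF continuous_on_mult_left[OF cG] continuous_on_const])
  also have "\<dots> \<le> integral {0..a} (\<lambda>x. f x * weight \<alpha> \<delta> x * (pv 0 - pv x))"
    by (rule inflow_lower_bound[OF a \<delta>(1)])
  finally show ?thesis .
qed

text \<open>Only the linear bound is used, so the ceiling sees neither C nor \<delta>; x powr (1 -
  \<alpha>) is integrable at 0 because \<alpha> < 2.\<close>

lemma potential_integral_le:
  assumes "0 < a" "0 < \<delta>"
  shows "integral {0..a} (\<lambda>x. f x * potential \<alpha> \<delta> a x) \<le> M1 / \<alpha> * (a powr (2 - \<alpha>) / (2 - \<alpha>))"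
proof -
  have hi: "((\<lambda>x. M1 / \<alpha> * x powr (1 - \<alpha>)) has_integral M1 / \<alpha> * (a powr (2 - \<alpha>) / (2 - \<alpha>))) {0..a}"
    using has_integral_mult_right[OF has_integral_powr_from_0[of "1 - \<alpha>" a], of "M1 / \<alpha>"] assms alpha
    by (simp add: algebra_simps)
  have "integral {0..a} (\<lambda>x. f x * potential \<alpha> \<delta> a x) \<le> integral {0..a} (\<lambda>x. M1 / \<alpha> * x powr (1 - \<alpha>))"
  proof (rule integral_le)
    show "(\<lambda>x. f x * potential \<alpha> \<delta> a x) integrable_on {0..a}"
      by (intro integrable_continuous_interval continuous_intros cont potential_cont assms)
    fix x assume x: "x \<in> {0..a}"
    show "f x * potential \<alpha> \<delta> a x \<le> M1 / \<alpha> * x powr (1 - \<alpha>)"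
    proof (cases "x = 0")
      case False
      then have "0 < x" using x by auto
      have "f x * potential \<alpha> \<delta> a x \<le> (M1 * x) * (x powr - \<alpha> / \<alpha>)"
        using linear_bound[of x] potential_le_powr[of \<delta> x a \<alpha>] potential_nonneg[of \<delta> \<alpha> a x] x M1 \<open>0 < x\<close> assms alpha
        by (intro mult_mono) auto
      also have "\<dots> = M1 / \<alpha> * x powr (1 - \<alpha>)"
        using powr_mult_base[of x "-\<alpha>"] \<open>0 < x\<close> by simp
      finally show ?thesis .
    qed (simp add: zero)
  qed (rule has_integral_integrable[OF hi])
  then show ?thesis using integral_unique[OF hi] by simp
qed

end

section \<open>Transport along curves\<close>

lemma lipschitz_of_deriv:
  fixes g g' :: "real \<Rightarrow> real"
  assumes d: "\<And>x. (g has_real_derivative g' x) (at x)" and b: "\<And>x. \<bar>g' x\<bar> \<le> B"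
  shows "\<bar>g x - g y\<bar> \<le> B * \<bar>x - y\<bar>"
  using field_differentiable_bound[of UNIV g g' B x y] d b
  by (auto simp: has_field_derivative_at_within)

lemma product_lipschitz_derivative:
  fixes p u :: "real \<Rightarrow> real"
  assumes p: "(p has_real_derivative p') (at x)"
    and pu: "((\<lambda>y. p y * u y) has_real_derivative d) (at x)"
    and u: "\<And>y. \<bar>u y - u x\<bar> \<le> L * \<bar>y - x\<bar>"
  shows "\<bar>d - p' * u x\<bar> \<le> L * \<bar>p x\<bar>"
proof -
  have L: "0 \<le> L" using u[of "x + 1"] by simp
  have ulim: "(u \<longlongrightarrow> u x) (at x)"
  proof -
    have "((\<lambda>y. L * \<bar>y - x\<bar>) \<longlongrightarrow> L * \<bar>x - x\<bar>) (at x)" by (intro tendsto_intros)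
    then have l0: "((\<lambda>y. L * \<bar>y - x\<bar>) \<longlongrightarrow> 0) (at x)" by simp
    have "((\<lambda>y. u y - u x) \<longlongrightarrow> 0) (at x)"
      by (rule Lim_null_comparison[OF always_eventually l0]) (use u in simp)
    then show ?thesis using LIM_zero_iff by blast
  qed
  have "((\<lambda>y. (p y * u y - p x * u x) / (y - x) - (p y - p x) / (y - x) * u y) \<longlongrightarrow> d - p' * u x) (at x)"
    by (rule tendsto_diff[OF pu[unfolded has_field_derivative_iff] tendsto_mult[OF p[unfolded has_field_derivative_iff] ulim]])
  then have lim: "((\<lambda>y. \<bar>(p y * u y - p x * u x) / (y - x) - (p y - p x) / (y - x) * u y\<bar>) \<longlongrightarrow> \<bar>d - p' * u x\<bar>) (at x)"
    by (rule tendsto_rabs)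
  show ?thesis
  proof (rule tendsto_upperbound[OF lim])
    have "\<bar>(p y * u y - p x * u x) / (y - x) - (p y - p x) / (y - x) * u y\<bar> \<le> L * \<bar>p x\<bar>" if "y \<noteq> x" for y
    proof -
      have "(p y * u y - p x * u x) / (y - x) - (p y - p x) / (y - x) * u y = p x * ((u y - u x) / (y - x))"
        by (simp only: times_divide_eq_left times_divide_eq_right diff_divide_distrib[symmetric]) (simp add: algebra_simps)
      also have "\<bar>\<dots>\<bar> = \<bar>p x\<bar> * (\<bar>u y - u x\<bar> / \<bar>y - x\<bar>)" by (simp add: abs_mult)
      also have "\<dots> \<le> \<bar>p x\<bar> * L"
        using u[of y] that by (intro mult_left_mono) (auto simp: divide_le_eq)
      finally show ?thesis by (simp add: mult.commute)
    qed
    then show "\<forall>\<^sub>F y in at x. \<bar>(p y * u y - p x * u x) / (y - x) - (p y - p x) / (y - x) * u y\<bar> \<le> L * \<bar>p x\<bar>"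
      by (auto simp: eventually_at_filter)
  qed simp
qed

text \<open>I may be a closed interval with one-sided time derivatives at its ends. Joint
  differentiability on I \<times> UNIV follows from continuity of the space derivative and existence
  of the time derivative at the point.\<close>

lemma deriv_along_curve:
  fixes \<rho> \<rho>x \<rho>t :: "real \<Rightarrow> real \<Rightarrow> real"
  assumes dx: "\<And>x t. t \<in> I \<Longrightarrow> ((\<lambda>y. \<rho> y t) has_real_derivative \<rho>x x t) (at x)"
    and cx: "continuous_on (UNIV \<times> I) (\<lambda>(x, t). \<rho>x x t)"
    and dt: "((\<lambda>s. \<rho> (X t) s) has_real_derivative \<rho>t (X t) t) (at t within I)"
    and X: "(X has_real_derivative X') (at t within I)" and t: "t \<in> I"
  shows "((\<lambda>s. \<rho> (X s) s) has_real_derivative \<rho>t (X t) t + \<rho>x (X t) t * X') (at t within I)"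
proof -
  have "((\<lambda>(s, y). \<rho> y s) has_derivative
      (\<lambda>(ts, ty). \<rho>t (X t) t * ts + blinfun_apply (blinfun_mult_right (\<rho>x (X t) t)) ty)) (at (t, X t) within I \<times> UNIV)"
  proof (rule has_derivative_partialsI)
    show "((\<lambda>s. \<rho> (X t) s) has_derivative (*) (\<rho>t (X t) t)) (at t within I)"
      using dt by (simp add: has_field_derivative_def)
    show "((\<lambda>y. \<rho> y s) has_derivative blinfun_apply (blinfun_mult_right (\<rho>x y s))) (at y within UNIV)"
      if "s \<in> I" for s y
      using dx[OF that, of y] by (simp add: has_field_derivative_def blinfun_mult_right.rep_eq)
    have "continuous_on (I \<times> UNIV) (\<lambda>(s, y). \<rho>x y s)"
      using continuous_on_compose2[OF cx, of "I \<times> UNIV" "\<lambda>p. (snd p, fst p)"]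
      by (simp add: split_def image_subset_iff continuous_intros)
    then have "continuous (at (t, X t) within I \<times> UNIV) (\<lambda>(s, y). \<rho>x y s)"
      using t by (auto simp: continuous_on_eq_continuous_within)
    then show "continuous (at (t, X t) within I \<times> UNIV) (\<lambda>(s, y). blinfun_mult_right (\<rho>x y s))"
      using bounded_linear.continuous[OF bounded_linear_blinfun_mult_right, of "at (t, X t) within I \<times> UNIV" "\<lambda>(s, y). \<rho>x y s"]
      by (simp add: split_def)
  qed auto
  then have 1: "((\<lambda>(s, y). \<rho> y s) has_derivative (\<lambda>(ts, ty). \<rho>t (X t) t * ts + \<rho>x (X t) t * ty)) (at (t, X t) within I \<times> UNIV)"
    by (simp add: blinfun_mult_right.rep_eq)
  have 2: "((\<lambda>s. (s, X s)) has_derivative (\<lambda>h. (h, X' * h))) (at t within I)"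
    using X by (intro has_derivative_Pair has_derivative_ident) (simp add: has_field_derivative_def)
  have "((\<lambda>s. (\<lambda>(s, y). \<rho> y s) (s, X s)) has_derivative (\<lambda>h. (\<lambda>(ts, ty). \<rho>t (X t) t * ts + \<rho>x (X t) t * ty) (h, X' * h))) (at t within I)"
    by (rule has_derivative_in_compose[OF 2 has_derivative_subset[OF 1]]) auto
  moreover have "(\<lambda>h. (\<lambda>(ts, ty). \<rho>t (X t) t * ts + \<rho>x (X t) t * ty) (h, X' * h)) = (*) (\<rho>t (X t) t + \<rho>x (X t) t * X')"
    by (auto simp: fun_eq_iff algebra_simps)
  ultimately show ?thesis by (simp add: has_field_derivative_def)
qed

text \<open>The flux r * v is differentiated as a whole, as the equation provides it; the
  integration by parts never needs a derivative of v.\<close>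

lemma transport_test:
  fixes r rt v :: "real \<Rightarrow> real \<Rightarrow> real" and \<phi> \<psi> :: "real \<Rightarrow> real"
  assumes pq: "p \<le> q" and t: "t \<in> {0..T}"
    and r: "\<And>x s. s \<in> {0..T} \<Longrightarrow> ((\<lambda>s. r x s) has_real_derivative rt x s) (at s within {0..T})"
    and cr: "\<And>s. s \<in> {0..T} \<Longrightarrow> continuous_on {p..q} (\<lambda>x. r x s)"
    and crt: "continuous_on (UNIV \<times> {0..T}) (\<lambda>(x, s). rt x s)"
    and pde: "\<And>x s. s \<in> {0..T} \<Longrightarrow> ((\<lambda>x. r x s * v x s) has_real_derivative - rt x s) (at x)"
    and \<phi>: "\<And>x. x \<in> {p..q} \<Longrightarrow> (\<phi> has_real_derivative - \<psi> x) (at x within {p..q})"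
    and c\<psi>: "continuous_on {p..q} \<psi>"
  shows "((\<lambda>s. integral {p..q} (\<lambda>x. r x s * \<phi> x)) has_real_derivative
     (r p t * v p t * \<phi> p - r q t * v q t * \<phi> q - integral {p..q} (\<lambda>x. r x t * v x t * \<psi> x))) (at t within {0..T})"
proof -
  have c\<phi>: "continuous_on {p..q} \<phi>"
    using \<phi> by (meson DERIV_continuous continuous_on_eq_continuous_within)
  have crv: "continuous_on {p..q} (\<lambda>x. r x t * v x t)"
    using pde[OF t] by (meson DERIV_isCont continuous_at_imp_continuous_on)
  have crt': "continuous_on {p..q} (\<lambda>x. rt x t)"
    using continuous_on_compose2[OF crt, of "{p..q}" "\<lambda>x. (x, t)"] t by (simp add: image_subset_iff continuous_intros)
  have "((\<lambda>s. integral (cbox p q) (\<lambda>x. r x s * \<phi> x)) has_field_derivative integral (cbox p q) (\<lambda>x. rt x t * \<phi> x)) (at t within {0..T})"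
  proof (rule leibniz_rule_field_derivative)
    show "((\<lambda>s. r x s * \<phi> x) has_real_derivative rt x s * \<phi> x) (at s within {0..T})" if "s \<in> {0..T}" for s x
      using r[OF that, of x] by (auto intro!: derivative_eq_intros)
    show "(\<lambda>x. r x s * \<phi> x) integrable_on cbox p q" if "s \<in> {0..T}" for s
      by (intro integrable_continuous continuous_intros) (use cr[OF that] c\<phi> in auto)
    show "continuous_on ({0..T} \<times> cbox p q) (\<lambda>(s, x). rt x s * \<phi> x)"
      unfolding split_def
      by (intro continuous_intros continuous_on_compose2[OF crt, of _ "\<lambda>p. (snd p, fst p)", simplified]
          continuous_on_compose2[OF c\<phi>]) auto
  qed (use t in auto)
  moreover have "integral {p..q} (\<lambda>x. rt x t * \<phi> x)
      = r p t * v p t * \<phi> p - r q t * v q t * \<phi> q - integral {p..q} (\<lambda>x. r x t * v x t * \<psi> x)"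
  proof -
    have "((\<lambda>x. r x t * v x t * \<phi> x) has_real_derivative - (rt x t * \<phi> x + r x t * v x t * \<psi> x)) (at x within {p..q})"
      if "x \<in> {p..q}" for x
      using DERIV_mult[OF has_field_derivative_at_within[OF pde[OF t, of x]] \<phi>[OF that]]
      by (simp add: algebra_simps)
    then have "((\<lambda>x. - (rt x t * \<phi> x + r x t * v x t * \<psi> x)) has_integral (r q t * v q t * \<phi> q - r p t * v p t * \<phi> p)) {p..q}"
      using pq by (intro fundamental_theorem_of_calculus) (auto simp flip: has_real_derivative_iff_has_vector_derivative)
    from integral_unique[OF has_integral_neg[OF this]]
    have "integral {p..q} (\<lambda>x. rt x t * \<phi> x + r x t * v x t * \<psi> x) = r p t * v p t * \<phi> p - r q t * v q t * \<phi> q"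
      by (simp only: minus_minus minus_diff_eq)
    moreover have "integral {p..q} (\<lambda>x. rt x t * \<phi> x + r x t * v x t * \<psi> x)
       = integral {p..q} (\<lambda>x. rt x t * \<phi> x) + integral {p..q} (\<lambda>x. r x t * v x t * \<psi> x)"
      by (intro integral_add integrable_continuous_interval continuous_intros crt' c\<phi> crv c\<psi>)
    ultimately show ?thesis by simp
  qed
  ultimately show ?thesis by simp
qed

section \<open>Solutions with bounded slope\<close>

lemma (in periodic_lipschitz) pv_shift:
  assumes "periodic_lipschitz \<alpha> N0 N1 (\<lambda>y. f (y + s))"
  shows "periodic_lipschitz.pv \<alpha> (\<lambda>y. f (y + s)) x = pv (x + s)"
proof -
  interpret s: periodic_lipschitz \<alpha> N0 N1 "\<lambda>y. f (y + s)" by fact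
  have "sym_int \<alpha> (\<lambda>y. f (y + s)) x = sym_int \<alpha> f (x + s)"
    by (simp add: sym_int_def fun_eq_iff algebra_simps)
  then show ?thesis using s.pv_seq[of x] pv_seq[of "x + s"] LIMSEQ_unique by metis
qed

locale bounded_solution =
  fixes \<alpha> c M :: real and \<rho> :: "real \<Rightarrow> real \<Rightarrow> real"
  assumes alpha: "0 < \<alpha>" "\<alpha> < 2" and c_pos: "0 < c"
    and smooth: "smooth_half (\<lambda>(x, t). \<rho> x t)"
    and per: "\<And>x t. 0 \<le> t \<Longrightarrow> \<rho> (x + 1) t = \<rho> x t"
    and pde: "\<And>x t. 0 \<le> t \<Longrightarrow> \<exists>d. ((\<lambda>s. \<rho> x s) has_real_derivative d) (at t within {0..})
                   \<and> ((\<lambda>y. \<rho> y t * velocity c \<alpha> (\<lambda>z. \<rho> z t) y) has_real_derivative (- d)) (at x)"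
    and bd: "\<And>x t. 0 \<le> t \<Longrightarrow> \<bar>\<rho> x t\<bar> \<le> M \<and> \<bar>deriv (\<lambda>y. \<rho> y t) x\<bar> \<le> M"
    and init_nonneg: "\<And>x. 0 \<le> \<rho> x 0"
begin

definition "\<rho>x x t = deriv (\<lambda>y. \<rho> y t) x"
definition "\<rho>xx x t = deriv (\<lambda>y. \<rho>x y t) x"
definition "\<rho>t x t = pdt (\<lambda>(x, t). \<rho> x t) (x, t)"
definition "u x t = velocity c \<alpha> (\<lambda>z. \<rho> z t) x"

lemma pdx_eq: "pdx (\<lambda>(x, t). \<rho> x t) = (\<lambda>(x, t). \<rho>x x t)"
  by (simp add: pdx_def \<rho>x_def fun_eq_iff)

lemma pdxx_eq: "pdx (\<lambda>(x, t). \<rho>x x t) = (\<lambda>(x, t). \<rho>xx x t)"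
  by (simp add: pdx_def \<rho>xx_def fun_eq_iff)

lemma partials_mem:
  "(\<lambda>(x, t). \<rho> x t) \<in> partials (\<lambda>(x, t). \<rho> x t)"
  "(\<lambda>(x, t). \<rho>x x t) \<in> partials (\<lambda>(x, t). \<rho> x t)"
  "(\<lambda>(x, t). \<rho>xx x t) \<in> partials (\<lambda>(x, t). \<rho> x t)"
  "(\<lambda>(x, t). \<rho>t x t) \<in> partials (\<lambda>(x, t). \<rho> x t)"
proof -
  show 1: "(\<lambda>(x, t). \<rho> x t) \<in> partials (\<lambda>(x, t). \<rho> x t)" by (rule partials.base)
  show 2: "(\<lambda>(x, t). \<rho>x x t) \<in> partials (\<lambda>(x, t). \<rho> x t)"
    using partials.dx[OF 1] by (simp add: pdx_eq)
  show "(\<lambda>(x, t). \<rho>xx x t) \<in> partials (\<lambda>(x, t). \<rho> x t)"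
    using partials.dx[OF 2] by (simp add: pdxx_eq)
  have "(\<lambda>(x, t). \<rho>t x t) = pdt (\<lambda>(x, t). \<rho> x t)" by (simp add: \<rho>t_def fun_eq_iff)
  then show "(\<lambda>(x, t). \<rho>t x t) \<in> partials (\<lambda>(x, t). \<rho> x t)"
    using partials.dt[OF 1] by simp
qed

lemmas partials_cont = smooth[unfolded smooth_half_def, THEN bspec, THEN conjunct1]

lemma cont:
  assumes "I \<subseteq> {0..}"
  shows "continuous_on (UNIV \<times> I) (\<lambda>(x, t). \<rho> x t)" "continuous_on (UNIV \<times> I) (\<lambda>(x, t). \<rho>x x t)"
    "continuous_on (UNIV \<times> I) (\<lambda>(x, t). \<rho>xx x t)" "continuous_on (UNIV \<times> I) (\<lambda>(x, t). \<rho>t x t)"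
  using assms by (auto intro: continuous_on_subset[OF partials_cont[OF partials_mem(1)]]
      continuous_on_subset[OF partials_cont[OF partials_mem(2)]]
      continuous_on_subset[OF partials_cont[OF partials_mem(3)]]
      continuous_on_subset[OF partials_cont[OF partials_mem(4)]])

lemma dx: "0 \<le> t \<Longrightarrow> ((\<lambda>y. \<rho> y t) has_real_derivative \<rho>x x t) (at x)"
  using smooth partials_mem(1) unfolding smooth_half_def \<rho>x_def
  by (fastforce simp: DERIV_deriv_iff_real_differentiable)

lemma dxx: "0 \<le> t \<Longrightarrow> ((\<lambda>y. \<rho>x y t) has_real_derivative \<rho>xx x t) (at x)"
  using smooth partials_mem(2) unfolding smooth_half_def \<rho>xx_def
  by (fastforce simp: DERIV_deriv_iff_real_differentiable)

text \<open>\<open>pdt\<close> chooses its value by THE, so the one-sided derivative has to be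
  unique; the filter is nontrivial because \<open>at_right t\<close> lies below it, also at t =
  0.\<close>

lemma dt_eq:
  assumes "0 \<le> t" "((\<lambda>s. \<rho> x s) has_real_derivative d) (at t within {0..})"
  shows "\<rho>t x t = d"
proof -
  have "at_right t \<le> at t within {0..}" using assms(1) by (intro at_le) auto
  then have "at t within {0..} \<noteq> bot"
    using trivial_limit_at_right_real[of t] by (metis le_bot)
  then have "(THE d. ((\<lambda>s. \<rho> x s) has_real_derivative d) (at t within {0..})) = d"
    using assms(2) has_field_derivative_unique by (intro the_equality) blast+
  then show ?thesis by (simp add: \<rho>t_def pdt_def)
qed

lemma dt: "0 \<le> t \<Longrightarrow> ((\<lambda>s. \<rho> x s) has_real_derivative \<rho>t x t) (at t within {0..})"
  using pde[of t x] dt_eq by blast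

lemma pde': "0 \<le> t \<Longrightarrow> ((\<lambda>y. \<rho> y t * u y t) has_real_derivative - \<rho>t x t) (at x)"
  using pde[of t x] dt_eq unfolding u_def by blast

lemma slice: "0 \<le> t \<Longrightarrow> periodic_lipschitz \<alpha> M M (\<lambda>x. \<rho> x t)"
  using alpha per bd lipschitz_of_deriv[of "\<lambda>y. \<rho> y t" "\<lambda>x. \<rho>x x t" M] dx[of t]
  by unfold_locales (auto simp: \<rho>x_def)

lemma M: "0 \<le> M" using bd[of 0 0] by auto

lemma u_eq: "0 \<le> t \<Longrightarrow> u x t = c * periodic_lipschitz.pv \<alpha> (\<lambda>x. \<rho> x t) x"
  by (simp add: u_def velocity_def periodic_lipschitz.pv_def[OF slice])

lemma u_cont: "I \<subseteq> {0..} \<Longrightarrow> continuous_on (UNIV \<times> I) (\<lambda>(x, t). u x t)"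
proof -
  assume I: "I \<subseteq> {0..}"
  have "continuous_on (UNIV \<times> I) (\<lambda>(x, t). periodic_lipschitz.pv \<alpha> (\<lambda>x. \<rho> x t) x)"
    by (rule pv_continuous[OF slice cont(1)]) (use I in auto)
  then have "continuous_on (UNIV \<times> I) (\<lambda>p. c * (\<lambda>(x, t). periodic_lipschitz.pv \<alpha> (\<lambda>x. \<rho> x t) x) p)"
    by (rule continuous_on_mult_left)
  then show ?thesis
    by (rule continuous_on_eq) (use I u_eq in auto)
qed

lemma \<rho>x_per: "0 \<le> t \<Longrightarrow> \<rho>x (x + 1) t = \<rho>x x t"
proof -
  assume t: "0 \<le> t"
  have "((\<lambda>y. \<rho> (y + 1) t) has_real_derivative \<rho>x (x + 1) t) (at x)"
    using dx[OF t, of "x + 1"] by (simp add: DERIV_shift)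
  then show ?thesis using dx[OF t, of x] DERIV_unique per[OF t] by auto
qed

lemma \<rho>xx_per: "0 \<le> t \<Longrightarrow> \<rho>xx (x + 1) t = \<rho>xx x t"
proof -
  assume t: "0 \<le> t"
  have "((\<lambda>y. \<rho>x (y + 1) t) has_real_derivative \<rho>xx (x + 1) t) (at x)"
    using dxx[OF t, of "x + 1"] by (simp add: DERIV_shift)
  then show ?thesis using dxx[OF t, of x] DERIV_unique \<rho>x_per[OF t] by auto
qed

text \<open>By periodicity {0..1} \<times> {0..T} suffices, and this set is compact. The bound may
  depend on T.\<close>

lemma second_deriv_bound: "\<exists>B\<ge>0. \<forall>x. \<forall>t\<in>{0..T}. \<bar>\<rho>xx x t\<bar> \<le> B"
proof -
  have "bounded ((\<lambda>(x, t). \<rho>xx x t) ` ({0..1} \<times> {0..T}))"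
    by (intro compact_imp_bounded compact_continuous_image compact_Times continuous_on_subset[OF cont(3)[of "{0..T}"]]) auto
  then obtain B where B: "\<And>x t. x \<in> {0..1} \<Longrightarrow> t \<in> {0..T} \<Longrightarrow> \<bar>\<rho>xx x t\<bar> \<le> B"
    unfolding bounded_iff by force
  have "\<bar>\<rho>xx x t\<bar> \<le> \<bar>B\<bar>" if t: "t \<in> {0..T}" for x t
  proof -
    have shift: "\<rho>xx (y + real n) t = \<rho>xx y t" for y n
    proof (induction n)
      case (Suc n) then show ?case using \<rho>xx_per[of t "y + real n"] t by (simp add: add_ac)
    qed simp
    have "\<rho>xx x t = \<rho>xx (frac x) t"
    proof (cases "0 \<le> \<lfloor>x\<rfloor>")
      case True
      then have "x = frac x + real (nat \<lfloor>x\<rfloor>)" by (simp add: frac_def)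
      then show ?thesis using shift[of "frac x" "nat \<lfloor>x\<rfloor>"] by metis
    next
      case False
      then have "frac x = x + real (nat (- \<lfloor>x\<rfloor>))" by (simp add: frac_def)
      then show ?thesis using shift[of x "nat (- \<lfloor>x\<rfloor>)"] by metis
    qed
    then show ?thesis using B[of "frac x" t] t frac_lt_1[of x] by (auto simp: less_imp_le)
  qed
  then show ?thesis by (intro exI[of _ "\<bar>B\<bar>"]) auto
qed

text \<open>The difference of two translates of the density is bounded by M * |x - y| and has
  Lipschitz constant B * |x - y|; \<open>pv_lipschitz\<close> then applies, at the cost of one more
  derivative of the density.\<close>

lemma u_lipschitz:
  assumes B: "\<And>x. \<bar>\<rho>xx x t\<bar> \<le> B" and t: "0 \<le> t"
  shows "\<bar>u x t - u y t\<bar> \<le> c * (2 * B / (2 - \<alpha>) + 8 * M) * \<bar>x - y\<bar>"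
proof -
  have lx: "\<bar>\<rho>x x t - \<rho>x y t\<bar> \<le> B * \<bar>x - y\<bar>" for x y
    by (rule lipschitz_of_deriv[OF dxx[OF t] B])
  have "periodic_lipschitz \<alpha> (M * \<bar>x - y\<bar>) (B * \<bar>x - y\<bar>) (\<lambda>z. \<rho> (z + x) t - \<rho> (z + y) t)"
  proof
    show "\<rho> (z + 1 + x) t - \<rho> (z + 1 + y) t = \<rho> (z + x) t - \<rho> (z + y) t" for z
      using per[OF t, of "z + x"] per[OF t, of "z + y"] by (simp add: add_ac)
    show "\<bar>\<rho> (z + x) t - \<rho> (z + y) t\<bar> \<le> M * \<bar>x - y\<bar>" for z
      using periodic_lipschitz.lip[OF slice[OF t], of "z + x" "z + y"] by simp
    show "\<bar>(\<rho> (z + x) t - \<rho> (z + y) t) - (\<rho> (w + x) t - \<rho> (w + y) t)\<bar> \<le> B * \<bar>x - y\<bar> * \<bar>z - w\<bar>" for z w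
    proof (rule lipschitz_of_deriv)
      show "((\<lambda>z. \<rho> (z + x) t - \<rho> (z + y) t) has_real_derivative \<rho>x (z + x) t - \<rho>x (z + y) t) (at z)" for z
      proof -
        have "((\<lambda>z. \<rho> (z + a) t) has_real_derivative \<rho>x (z + a) t) (at z)" for a
          using dx[OF t, of "z + a"] by (simp add: DERIV_shift)
        then show ?thesis by (intro DERIV_diff)
      qed
      show "\<bar>\<rho>x (z + x) t - \<rho>x (z + y) t\<bar> \<le> B * \<bar>x - y\<bar>" for z
        using lx[of "z + x" "z + y"] by simp
    qed
  qed (use alpha in auto)
  from pv_lipschitz[OF slice[OF t] this]
  have "c * \<bar>periodic_lipschitz.pv \<alpha> (\<lambda>x. \<rho> x t) x - periodic_lipschitz.pv \<alpha> (\<lambda>x. \<rho> x t) y\<bar>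
      \<le> c * (2 * (B * \<bar>x - y\<bar>) / (2 - \<alpha>) + 8 * (M * \<bar>x - y\<bar>))"
    using c_pos by (intro mult_left_mono) auto
  moreover have "\<bar>u x t - u y t\<bar> = c * \<bar>periodic_lipschitz.pv \<alpha> (\<lambda>x. \<rho> x t) x - periodic_lipschitz.pv \<alpha> (\<lambda>x. \<rho> x t) y\<bar>"
    using c_pos by (simp add: u_eq[OF t] abs_mult flip: right_diff_distrib)
  ultimately show ?thesis by (simp add: algebra_simps)
qed

lemma u_lipschitz_ex: "\<exists>L\<ge>0. \<forall>t\<in>{0..T}. \<forall>x y. \<bar>u x t - u y t\<bar> \<le> L * \<bar>x - y\<bar>"
proof -
  obtain B where B: "B \<ge> 0" "\<forall>x. \<forall>t\<in>{0..T}. \<bar>\<rho>xx x t\<bar> \<le> B" using second_deriv_bound by blast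
  have "\<forall>t\<in>{0..T}. \<forall>x y. \<bar>u x t - u y t\<bar> \<le> c * (2 * B / (2 - \<alpha>) + 8 * M) * \<bar>x - y\<bar>"
    using B u_lipschitz by auto
  moreover have "c * (2 * B / (2 - \<alpha>) + 8 * M) \<ge> 0" using B c_pos alpha M by simp
  ultimately show ?thesis by blast
qed

lemma deriv_along_flow:
  assumes T: "t \<in> {0..T}" and X: "(X has_real_derivative u (X t) t) (at t within {0..T})"
  shows "((\<lambda>s. \<rho> (X s) s) has_real_derivative \<rho>t (X t) t + \<rho>x (X t) t * u (X t) t) (at t within {0..T})"
  by (rule deriv_along_curve[where \<rho>x = \<rho>x])
    (use T X dx cont(2)[of "{0..T}"] in \<open>auto intro: DERIV_subset[OF dt]\<close>)

text \<open>Stands in for the formal identity that the density changes along the flow at rate -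
  \<rho> * u_x; the inequality is all that Gronwall needs, and u_x is never formed.\<close>

lemma material_deriv_bound:
  assumes "0 \<le> t" "\<And>x y. \<bar>u x t - u y t\<bar> \<le> L * \<bar>x - y\<bar>"
  shows "\<bar>\<rho>t x t + \<rho>x x t * u x t\<bar> \<le> L * \<bar>\<rho> x t\<bar>"
proof -
  have "\<bar>- \<rho>t x t - \<rho>x x t * u x t\<bar> \<le> L * \<bar>\<rho> x t\<bar>"
    by (rule product_lipschitz_derivative[OF dx pde']) (use assms in auto)
  then show ?thesis by (simp add: abs_minus_commute[of "- \<rho>t x t"])
qed

text \<open>The characteristic through (x, t) is traced back to time 0, where the density is
  nonnegative; Y solves the time-reversed equation.\<close>

lemma nonneg:
  assumes "0 \<le> t" shows "0 \<le> \<rho> x t"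
proof -
  obtain L where L: "\<And>s x y. s \<in> {0..t} \<Longrightarrow> \<bar>u x s - u y s\<bar> \<le> L * \<bar>x - y\<bar>"
    using u_lipschitz_ex[of t] by blast
  obtain Y where Y0: "Y 0 = x"
    and Y: "\<And>s. s \<in> {0..t} \<Longrightarrow> (Y has_real_derivative - u (Y s) (t - s)) (at s within {0..t})"
  proof (rule ode_exists[of t "\<lambda>x s. - u x (t - s)" L x])
    show "continuous_on (UNIV \<times> {0..t}) (\<lambda>(x, s). - u x (t - s))"
      unfolding split_def
      by (intro continuous_intros continuous_on_compose2[OF u_cont[of "{0..t}"], of _ "\<lambda>p. (fst p, t - snd p)", simplified]) auto
    show "\<bar>- u x (t - s) - - u y (t - s)\<bar> \<le> L * \<bar>x - y\<bar>" if "s \<in> {0..t}" for x y s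
      using L[of "t - s" x y] that by auto
  qed (use assms in auto)
  define X where "X s = Y (t - s)" for s
  have X: "(X has_real_derivative u (X s) s) (at s within {0..t})" if s: "s \<in> {0..t}" for s
  proof -
    have im: "(\<lambda>s. t - s) ` {0..t} = {0..t}" by (auto simp: image_iff intro: bexI[of _ "t - _"])
    have "(Y has_real_derivative - u (Y (t - s)) (t - (t - s))) (at (t - s) within (\<lambda>s. t - s) ` {0..t})"
      unfolding im using s by (intro Y) auto
    moreover have "((\<lambda>s. t - s) has_real_derivative - 1) (at s within {0..t})"
      by (auto intro!: derivative_eq_intros)
    ultimately show ?thesis
      using DERIV_image_chain by (fastforce simp: X_def[abs_def] o_def)
  qed
  have "0 \<le> \<rho> (X t) t"
  proof (rule gronwall_nonneg[of t "\<lambda>s. \<rho> (X s) s" _ L])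
    show "((\<lambda>s. \<rho> (X s) s) has_real_derivative \<rho>t (X s) s + \<rho>x (X s) s * u (X s) s) (at s within {0..t})"
      if "s \<in> {0..t}" for s by (rule deriv_along_flow[OF that X[OF that]])
    show "\<bar>\<rho>t (X s) s + \<rho>x (X s) s * u (X s) s\<bar> \<le> L * \<bar>\<rho> (X s) s\<bar>" if "s \<in> {0..t}" for s
      by (rule material_deriv_bound) (use that L in auto)
  qed (use assms init_nonneg in auto)
  then show ?thesis by (simp add: X_def Y0)
qed

end

lemma eventually_powr_less:
  fixes \<beta> e :: real
  assumes "0 < \<beta>" "0 < e"
  shows "eventually (\<lambda>d. d powr \<beta> < e) (at_right 0)"
proof -
  have "((\<lambda>d::real. d powr \<beta>) \<longlongrightarrow> 0) (at_right 0)"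
    by (rule tendsto_zero_powrI[OF _ tendsto_const])
      (use assms in \<open>auto simp: eventually_at_filter intro: tendsto_ident_at\<close>)
  then show ?thesis using assms(2) by (rule order_tendstoD)
qed

section \<open>The frame moving with a vacuum point\<close>

context bounded_solution begin

context
  fixes X :: "real \<Rightarrow> real" and T B :: real
  assumes T: "0 \<le> T"
    and X: "\<And>t. t \<in> {0..T} \<Longrightarrow> (X has_real_derivative u (X t) t) (at t within {0..T})"
    and X0: "\<rho> (X 0) 0 = 0"
    and B: "\<And>x t. t \<in> {0..T} \<Longrightarrow> \<bar>\<rho>xx x t\<bar> \<le> B"
begin

lemma vacuum_transported: "t \<in> {0..T} \<Longrightarrow> \<rho> (X t) t = 0"
proof -
  assume t: "t \<in> {0..T}"
  obtain L where L: "\<And>s x y. s \<in> {0..T} \<Longrightarrow> \<bar>u x s - u y s\<bar> \<le> L * \<bar>x - y\<bar>"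
    using u_lipschitz_ex[of T] by blast
  show ?thesis
  proof (rule gronwall_zero[of T "\<lambda>s. \<rho> (X s) s" _ L 0])
    show "((\<lambda>s. \<rho> (X s) s) has_real_derivative \<rho>t (X s) s + \<rho>x (X s) s * u (X s) s) (at s within {0..T})"
      if "s \<in> {0..T}" for s by (rule deriv_along_flow[OF that X[OF that]])
    show "\<bar>\<rho>t (X s) s + \<rho>x (X s) s * u (X s) s\<bar> \<le> L * \<bar>\<rho> (X s) s\<bar>" if "s \<in> {0..T}" for s
      by (rule material_deriv_bound) (use that L in auto)
  qed (use X0 t in auto)
qed

text \<open>A zero of a nonnegative density is a minimum, so the slope vanishes there, and
  integrating the second derivative bound B twice gives the quadratic bound.\<close>

lemma frame_profile:
  assumes t: "t \<in> {0..T}"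
  shows "vacuum_profile \<alpha> M M (\<lambda>x. \<rho> (x + X t) t) B"
proof -
  have t0: "0 \<le> t" using t by simp
  have d: "((\<lambda>x. \<rho> (x + X t) t) has_real_derivative \<rho>x (x + X t) t) (at x)" for x
    using dx[OF t0, of "x + X t"] by (simp add: DERIV_shift)
  have d0: "\<rho>x (X t) t = 0"
    using DERIV_local_min[OF dx[OF t0, of "X t"], of 1] nonneg[OF t0] vacuum_transported[OF t] by auto
  have lx: "\<bar>\<rho>x (z + X t) t\<bar> \<le> B * \<bar>z\<bar>" for z
    using lipschitz_of_deriv[OF dxx[OF t0] B[OF t], of "z + X t" "X t"] d0 by simp
  have B0: "0 \<le> B" using B[OF t, of 0] by auto
  have q: "\<rho> (x + X t) t \<le> B * x\<^sup>2" for x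
  proof -
    have "norm (\<rho> (x + X t) t - \<rho> (0 + X t) t) \<le> B * \<bar>x\<bar> * norm (x - 0)"
    proof (rule field_differentiable_bound)
      show "((\<lambda>x. \<rho> (x + X t) t) has_field_derivative \<rho>x (z + X t) t) (at z within {- \<bar>x\<bar>..\<bar>x\<bar>})" for z
        using d by (rule has_field_derivative_at_within)
      show "norm (\<rho>x (z + X t) t) \<le> B * \<bar>x\<bar>" if "z \<in> {- \<bar>x\<bar>..\<bar>x\<bar>}" for z
      proof -
        have "\<bar>z\<bar> \<le> \<bar>x\<bar>" using that by auto
        from order.trans[OF lx[of z] mult_left_mono[OF this B0]] show ?thesis by simp
      qed
    qed auto
    then show ?thesis using vacuum_transported[OF t] by (simp add: power2_eq_square)
  qed
  have "periodic_lipschitz \<alpha> M M (\<lambda>x. \<rho> (x + X t) t)"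
  proof
    show "\<rho> (x + 1 + X t) t = \<rho> (x + X t) t" for x using per[OF t0, of "x + X t"] by (simp add: add_ac)
    show "\<bar>\<rho> (x + X t) t - \<rho> (y + X t) t\<bar> \<le> M * \<bar>x - y\<bar>" for x y
      using periodic_lipschitz.lip[OF slice[OF t0], of "x + X t" "y + X t"] by simp
  qed (use alpha bd t0 in auto)
  then show ?thesis
    by (rule vacuum_profile.intro) (unfold_locales, use q nonneg t0 vacuum_transported[OF t] in auto)
qed

lemma X_cont: "continuous_on {0..T} X"
  using X by (meson DERIV_continuous continuous_on_eq_continuous_within)

text \<open>The moving frame adds \<rho>x * u (X t) t to the time derivative and takes the same term
  away from the space derivative of the flux, so the equation keeps its form with the relative
  velocity v.\<close>

lemma frame_test:
  assumes t: "t \<in> {0..T}" and pq: "p \<le> q"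
    and \<phi>: "\<And>x. x \<in> {p..q} \<Longrightarrow> (\<phi> has_real_derivative - \<psi> x) (at x within {p..q})"
    and c\<psi>: "continuous_on {p..q} \<psi>"
  defines "r \<equiv> \<lambda>x t. \<rho> (x + X t) t" and "v \<equiv> \<lambda>x t. u (x + X t) t - u (X t) t"
  shows "((\<lambda>s. integral {p..q} (\<lambda>x. r x s * \<phi> x)) has_real_derivative
     (r p t * v p t * \<phi> p - r q t * v q t * \<phi> q - integral {p..q} (\<lambda>x. r x t * v x t * \<psi> x))) (at t within {0..T})"
proof (rule transport_test[OF pq t _ _ _ _ \<phi> c\<psi>])
  let ?rt = "\<lambda>x t. \<rho>t (x + X t) t + \<rho>x (x + X t) t * u (X t) t"
  show "((\<lambda>s. r x s) has_real_derivative ?rt x s) (at s within {0..T})" if s: "s \<in> {0..T}" for x s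
    unfolding r_def
  proof (rule deriv_along_curve[where \<rho>x = \<rho>x])
    show "((\<lambda>s. x + X s) has_real_derivative u (X s) s) (at s within {0..T})"
      using X[OF s] by (auto intro!: derivative_eq_intros)
  qed (use s dx cont(2)[of "{0..T}"] in \<open>auto intro: DERIV_subset[OF dt]\<close>)
  show "continuous_on {p..q} (\<lambda>x. r x s)" if "s \<in> {0..T}" for s
  proof -
    interpret vacuum_profile \<alpha> M M "\<lambda>x. \<rho> (x + X s) s" B by (rule frame_profile[OF that])
    show ?thesis unfolding r_def by (rule cont)
  qed
  have cX: "continuous_on (UNIV \<times> {0..T}) (\<lambda>p. X (snd p))"
    by (rule continuous_on_compose2[OF X_cont]) (auto intro!: continuous_intros)
  show "continuous_on (UNIV \<times> {0..T}) (\<lambda>(x, s). ?rt x s)"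
    unfolding split_def
    by (intro continuous_intros cX
        continuous_on_compose2[OF cont(4)[of "{0..T}"], of _ "\<lambda>p. (fst p + X (snd p), snd p)", simplified]
        continuous_on_compose2[OF cont(2)[of "{0..T}"], of _ "\<lambda>p. (fst p + X (snd p), snd p)", simplified]
        continuous_on_compose2[OF u_cont[of "{0..T}"], of _ "\<lambda>p. (X (snd p), snd p)", simplified]) auto
  show "((\<lambda>x. r x s * v x s) has_real_derivative - ?rt x s) (at x)" if s: "s \<in> {0..T}" for x s
  proof -
    have s0: "0 \<le> s" using s by simp
    have 1: "((\<lambda>x. \<rho> (x + X s) s * u (x + X s) s) has_real_derivative - \<rho>t (x + X s) s) (at x)"
      using pde'[OF s0, of "x + X s"] by (simp add: DERIV_shift)
    have 2: "((\<lambda>x. \<rho> (x + X s) s) has_real_derivative \<rho>x (x + X s) s) (at x)"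
      using dx[OF s0, of "x + X s"] by (simp add: DERIV_shift)
    have "((\<lambda>x. \<rho> (x + X s) s * u (x + X s) s - \<rho> (x + X s) s * u (X s) s) has_real_derivative
        - \<rho>t (x + X s) s - \<rho>x (x + X s) s * u (X s) s) (at x)"
      by (intro DERIV_diff 1 DERIV_cmult_right 2)
    then show ?thesis unfolding r_def v_def by (simp add: right_diff_distrib)
  qed
qed

lemma frame_velocity:
  assumes t: "t \<in> {0..T}"
  shows "u (x + X t) t - u (X t) t
    = - (c * (periodic_lipschitz.pv \<alpha> (\<lambda>x. \<rho> (x + X t) t) 0 - periodic_lipschitz.pv \<alpha> (\<lambda>x. \<rho> (x + X t) t) x))"
proof -
  interpret r: vacuum_profile \<alpha> M M "\<lambda>x. \<rho> (x + X t) t" B by (rule frame_profile[OF t])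
  have t0: "0 \<le> t" using t by simp
  show ?thesis
    using periodic_lipschitz.pv_shift[OF slice[OF t0] r.periodic_lipschitz_axioms, of x]
      periodic_lipschitz.pv_shift[OF slice[OF t0] r.periodic_lipschitz_axioms, of 0]
    by (simp add: u_eq[OF t0] algebra_simps)
qed

text \<open>The test function is 1 over one period; the boundary terms vanish because X t and X t +
  1 are both zeros of the density.\<close>

lemma frame_mass:
  assumes t: "t \<in> {0..T}"
  shows "integral {0..1} (\<lambda>x. \<rho> (x + X t) t) = integral {0..1} (\<lambda>x. \<rho> (x + X 0) 0)"
proof -
  have "((\<lambda>s. integral {0..1} (\<lambda>x. \<rho> (x + X s) s * 1)) has_real_derivative 0) (at s within {0..T})"
    if s: "s \<in> {0..T}" for s
  proof -
    have "\<rho> (1 + X s) s = 0"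
      using per[of s "X s"] vacuum_transported[OF s] s by (simp add: add.commute)
    then show ?thesis
      using frame_test[OF s, of 0 1 "\<lambda>x. 1" "\<lambda>x. 0"] vacuum_transported[OF s] by simp
  qed
  then obtain k where "\<And>s. s \<in> {0..T} \<Longrightarrow> integral {0..1} (\<lambda>x. \<rho> (x + X s) s * 1) = k"
    using has_field_derivative_zero_constant[of "{0..T}" "\<lambda>s. integral {0..1} (\<lambda>x. \<rho> (x + X s) s * 1)"]
    by auto
  from this[OF t] this[of 0] T show ?thesis by simp
qed

lemma frame_potential_growth:
  assumes t: "t \<in> {0..T}" and a: "0 < a" "a \<le> 1/2" and \<delta>: "0 < \<delta>" "\<delta> \<le> a"
    and m: "0 \<le> m" "2 * m \<le> integral {0..1} (\<lambda>x. \<rho> (x + X 0) 0)" "M * a \<le> m"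
    and small: "\<alpha> < 1 \<Longrightarrow> 4 * M * a powr (1 - \<alpha>) \<le> \<alpha> * m"
  shows "\<exists>D. ((\<lambda>s. integral {0..a} (\<lambda>x. \<rho> (x + X s) s * potential \<alpha> \<delta> a x)) has_real_derivative D) (at t within {0..T})
    \<and> c * (\<alpha>\<^sup>2 * m / 2) * integral {0..a} (\<lambda>x. \<rho> (x + X t) t * potential \<alpha> \<delta> a x)
      - c * ((\<alpha> * m / 2 * (B * (\<alpha> + 1) * \<delta> powr (2 - \<alpha>)) + 2 * B\<^sup>2 * \<delta> powr (4 - 2 * \<alpha>)) * a) \<le> D"
proof -
  interpret r: vacuum_profile \<alpha> M M "\<lambda>x. \<rho> (x + X t) t" B by (rule frame_profile[OF t])
  let ?r = "\<lambda>x. \<rho> (x + X t) t"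
  let ?I = "integral {0..a} (\<lambda>x. ?r x * weight \<alpha> \<delta> x * (r.pv 0 - r.pv x))"
  have "((\<lambda>s. integral {0..a} (\<lambda>x. \<rho> (x + X s) s * potential \<alpha> \<delta> a x)) has_real_derivative
      - integral {0..a} (\<lambda>x. ?r x * (u (x + X t) t - u (X t) t) * weight \<alpha> \<delta> x)) (at t within {0..T})"
    using frame_test[OF t, of 0 a "potential \<alpha> \<delta> a" "weight \<alpha> \<delta>"] potential_deriv[OF \<delta>(1)] weight_cont[OF \<delta>(1)] a
      vacuum_transported[OF t]
    by (simp add: potential_def)
  moreover have "- integral {0..a} (\<lambda>x. ?r x * (u (x + X t) t - u (X t) t) * weight \<alpha> \<delta> x) = c * ?I"
  proof -
    have "(\<lambda>x. ?r x * (u (x + X t) t - u (X t) t) * weight \<alpha> \<delta> x)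
        = (\<lambda>x. (- c) * (?r x * weight \<alpha> \<delta> x * (r.pv 0 - r.pv x)))"
      unfolding frame_velocity[OF t] by (simp add: fun_eq_iff mult_ac)
    then show ?thesis by (simp only: integral_mult_right minus_mult_left minus_minus)
  qed
  \<comment> \<open>Of the conserved mass, at least 2 * m, at most M * a \<le> m lies in
    {0..a}.\<close>
  moreover have "m \<le> integral {a..1} ?r"
  proof -
    have "integral {0..1} ?r = integral {0..a} ?r + integral {a..1} ?r"
      using a by (intro Henstock_Kurzweil_Integration.integral_combine[symmetric] integrable_continuous_interval r.cont) auto
    moreover have "integral {0..a} ?r \<le> M * a"
      using integral_bound[of 0 a ?r M] a r.bd r.cont by auto
    ultimately show ?thesis using m frame_mass[OF t] by simp
  qed
  then have "c * (\<alpha>\<^sup>2 * m / 2 * integral {0..a} (\<lambda>x. ?r x * potential \<alpha> \<delta> a x)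
      - (\<alpha> * m / 2 * (B * (\<alpha> + 1) * \<delta> powr (2 - \<alpha>)) + 2 * B\<^sup>2 * \<delta> powr (4 - 2 * \<alpha>)) * a) \<le> c * ?I"
    using r.inflow_ge_potential[OF a \<delta> m(1) _ small] c_pos by (intro mult_left_mono) auto
  ultimately show ?thesis
    by (intro exI[of _ "c * ?I"]) (simp only: right_diff_distrib mult.assoc)
qed

end

lemma vacuum_impossible:
  assumes z: "\<rho> z 0 = 0" and p: "z \<le> p" "0 < \<rho> p 0"
  shows False
proof -
  have c0: "continuous_on S (\<lambda>x. \<rho> x 0)" for S
    using dx[of 0] by (meson DERIV_isCont continuous_at_imp_continuous_on order_refl)
  \<comment> \<open>The last zero before p is taken as the vacuum: the density is positive
    immediately to its right, so the energy on {0..a} is initially positive for every choice of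
    a.\<close>
  define S where "S = {x \<in> {..p}. \<rho> x 0 = 0}"
  define x0 where "x0 = Sup S"
  have "closed S"
    unfolding S_def by (intro continuous_closed_preimage_constant c0) auto
  moreover have Sne: "S \<noteq> {}" "bdd_above S" using z p by (auto simp: S_def)
  ultimately have "x0 \<in> S" unfolding x0_def by (intro closed_contains_Sup)
  then have x0: "\<rho> x0 0 = 0" "x0 < p"
    using p by (auto simp: S_def order.order_iff_strict)
  have pos: "0 < \<rho> x 0" if "x0 < x" "x \<le> p" for x
  proof -
    have "x \<notin> S" using cSup_upper[OF _ Sne(2), of x] that by (auto simp: x0_def)
    then show ?thesis using that nonneg[of 0 x] by (auto simp: S_def order.order_iff_strict)
  qed
  let ?r0 = "\<lambda>x. \<rho> (x + x0) 0"
  have cr0: "continuous_on A ?r0" for A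
    by (intro continuous_on_compose2[OF c0] continuous_intros) auto
  have integral_pos: "0 < integral {0..b} h"
    if "0 < b" "continuous_on {0..b} h" "\<And>x. x \<in> {0..b} \<Longrightarrow> 0 \<le> h x" "x \<in> {0..b}" "0 < h x"
    for b x :: real and h :: "real \<Rightarrow> real"
    using integral_eq_0_iff[of 0 b h] Henstock_Kurzweil_Integration.integral_nonneg[of h "{0..b}"]
      integrable_continuous_interval[OF that(2)] that by (force simp: order.order_iff_strict)
  \<comment> \<open>Half of the mass of a period; the other half allows for what may enter
    {0..a}.\<close>
  define m where "m = integral {0..1} ?r0 / 2"
  have m: "0 < m"
  proof -
    let ?x = "min 1 (p - x0)"
    have "0 < ?r0 ?x" using x0 by (intro pos) auto
    then have "0 < integral {0..1} ?r0"
      using x0 nonneg[of 0] by (intro integral_pos[of 1 ?r0 ?x] cr0) auto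
    then show ?thesis by (simp add: m_def)
  qed
  have small_ev: "eventually (\<lambda>a. 0 < a \<and> a < d) (at_right 0)" if "0 < d" for d :: real
    using eventually_at_right_real[OF that] by (auto elim: eventually_mono)
  \<comment> \<open>M + 1 instead of M avoids division by zero.\<close>
  have "eventually (\<lambda>a. \<alpha> < 1 \<longrightarrow> a powr (1 - \<alpha>) < \<alpha> * m / (4 * (M + 1))) (at_right 0)"
    using eventually_powr_less[of "1 - \<alpha>" "\<alpha> * m / (4 * (M + 1))"] m M alpha
    by (cases "\<alpha> < 1") (auto elim!: eventually_mono)
  moreover have "0 < m / (M + 1)" using m M by simp
  ultimately have "eventually (\<lambda>a. (0 < a \<and> a < 1/2) \<and> (0 < a \<and> a < m / (M + 1))
      \<and> (\<alpha> < 1 \<longrightarrow> a powr (1 - \<alpha>) < \<alpha> * m / (4 * (M + 1)))) (at_right 0)"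
    by (intro eventually_conj small_ev) auto
  then obtain a where a: "0 < a" "a < 1/2" "a < m / (M + 1)" "\<alpha> < 1 \<Longrightarrow> a powr (1 - \<alpha>) < \<alpha> * m / (4 * (M + 1))"
    using eventually_happens'[OF trivial_limit_at_right_real] by blast
  have Ma: "M * a \<le> m"
  proof -
    have "(M + 1) * a \<le> m" using a(3) M by (simp add: field_simps)
    then show ?thesis using a(1) by (simp add: algebra_simps)
  qed
  have small: "4 * M * a powr (1 - \<alpha>) \<le> \<alpha> * m" if "\<alpha> < 1"
  proof -
    have "4 * M * a powr (1 - \<alpha>) \<le> 4 * (M + 1) * a powr (1 - \<alpha>)" by (intro mult_right_mono) auto
    also have "\<dots> \<le> \<alpha> * m" using a(4)[OF that] M by (simp add: field_simps)
    finally show ?thesis .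
  qed
  \<comment> \<open>The cap is a here, so that G0, and with it T, can be fixed before
    \<delta>.\<close>
  define G0 where "G0 = integral {0..a} (\<lambda>x. ?r0 x * potential \<alpha> a a x)"
  have G0: "0 < G0"
  proof -
    let ?x = "min (a / 2) (p - x0)"
    have x: "0 < ?x" "?x < a" using a x0 by auto
    have "potential \<alpha> a a ?x = integral {?x..a} (\<lambda>x. a powr (- 1 - \<alpha>))"
      unfolding potential_def by (intro integral_cong) (auto simp: weight_def)
    also have "\<dots> = (a - ?x) * a powr (- 1 - \<alpha>)" using x by simp
    finally have "0 < potential \<alpha> a a ?x" using x a by simp
    moreover have "0 < ?r0 ?x" using x0 a by (intro pos) auto
    ultimately show ?thesis
      unfolding G0_def using x a nonneg[of 0]
      by (intro integral_pos[of a _ ?x] continuous_intros cr0 potential_cont mult_nonneg_nonneg potential_nonneg) auto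
  qed
  define l where "l = c * (\<alpha>\<^sup>2 * m / 2)"
  have l: "0 < l" using c_pos alpha m by (simp add: l_def)
  define Gmax where "Gmax = M / \<alpha> * (a powr (2 - \<alpha>) / (2 - \<alpha>))"
  have Gmax: "0 \<le> Gmax" using M alpha by (simp add: Gmax_def)
  \<comment> \<open>By exp (l * T) \<ge> 1 + l * T this time lifts G0 / 2 to at least G0 / 2 + Gmax,
    which exceeds the ceiling.\<close>
  define T where "T = 2 * Gmax / (G0 * l)"
  have T: "0 \<le> T" using Gmax G0 l by (simp add: T_def)
  obtain B where B: "0 \<le> B" "\<And>x t. t \<in> {0..T} \<Longrightarrow> \<bar>\<rho>xx x t\<bar> \<le> B"
    using second_deriv_bound[of T] by blast
  obtain L where L: "\<And>s x y. s \<in> {0..T} \<Longrightarrow> \<bar>u x s - u y s\<bar> \<le> L * \<bar>x - y\<bar>"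
    using u_lipschitz_ex[of T] by blast
  obtain X where X0: "X 0 = x0"
    and X: "\<And>t. t \<in> {0..T} \<Longrightarrow> (X has_real_derivative u (X t) t) (at t within {0..T})"
    by (rule ode_exists[OF T u_cont L]) auto
  have X0z: "\<rho> (X 0) 0 = 0" using X0 x0 by simp
  let ?e1 = "\<lambda>\<delta>. \<delta> powr (2 - \<alpha>)" and ?e2 = "\<lambda>\<delta>. \<delta> powr (4 - 2 * \<alpha>)"
  \<comment> \<open>Both powers of \<delta> have positive exponents since \<alpha> < 2, so E
    \<delta> vanishes with \<delta> however large B is. Once it is below l * G0 / 2, at least G0 / 2
    of the initial energy lies above the equilibrium E \<delta> / l.\<close>
  define E where "E \<delta> = c * ((\<alpha> * m / 2 * (B * (\<alpha> + 1) * ?e1 \<delta>) + 2 * B\<^sup>2 * ?e2 \<delta>) * a)" for \<delta>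
  have "(E \<longlongrightarrow> c * ((\<alpha> * m / 2 * (B * (\<alpha> + 1) * 0) + 2 * B\<^sup>2 * 0) * a)) (at_right 0)"
    unfolding E_def
    by (intro tendsto_intros tendsto_zero_powrI[OF _ tendsto_const])
      (use alpha in \<open>auto simp: eventually_at_filter intro: tendsto_ident_at\<close>)
  then have "eventually (\<lambda>\<delta>. E \<delta> < l * G0 / 2) (at_right 0)"
    using l G0 by (intro order_tendstoD(2)) auto
  then have "eventually (\<lambda>\<delta>. E \<delta> < l * G0 / 2 \<and> 0 < \<delta> \<and> \<delta> < a) (at_right 0)"
    using small_ev[OF a(1)] by (rule eventually_conj)
  then obtain \<delta> where \<delta>: "E \<delta> < l * G0 / 2" "0 < \<delta>" "\<delta> < a"
    using eventually_happens'[OF trivial_limit_at_right_real] by blast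
  define G where "G t = integral {0..a} (\<lambda>x. \<rho> (x + X t) t * potential \<alpha> \<delta> a x)" for t
  have "\<exists>D. (G has_real_derivative D) (at t within {0..T}) \<and> l * G t - E \<delta> \<le> D" if "t \<in> {0..T}" for t
    using frame_potential_growth[OF T X X0z B(2) that a(1) _ \<delta>(2) _ _ _ Ma small] a \<delta> m
    unfolding G_def[abs_def] l_def E_def by (simp add: m_def X0)
  then obtain G' where G': "\<And>t. t \<in> {0..T} \<Longrightarrow> (G has_real_derivative G' t) (at t within {0..T})"
    "\<And>t. t \<in> {0..T} \<Longrightarrow> l * G t - E \<delta> \<le> G' t" by metis
  have "G0 \<le> G 0"
    unfolding G0_def G_def X0 using a \<delta> alpha nonneg[of 0]
    by (intro integral_le integrable_continuous_interval continuous_intros cr0 potential_cont mult_left_mono potential_antimono) auto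
  moreover have "E \<delta> / l \<le> G0 / 2" using \<delta>(1) l by (simp add: field_simps)
  moreover have "0 \<le> E \<delta>" using c_pos B(1) alpha m a by (simp add: E_def)
  then have "0 \<le> E \<delta> / l" using l by simp
  ultimately have gap: "G0 / 2 \<le> G 0 - E \<delta> / l" by simp
  have "(1 + l * T) * (G0 / 2) \<le> exp (l * T) * (G0 / 2)"
    using G0 by (intro mult_right_mono exp_ge_add_one_self) auto
  also have "\<dots> \<le> exp (l * T) * (G 0 - E \<delta> / l)" using gap by (intro mult_left_mono) auto
  also have "\<dots> \<le> G T - E \<delta> / l" by (rule gronwall_lower[OF G' l T])
  also have "\<dots> \<le> G T" using \<open>0 \<le> E \<delta> / l\<close> by simp
  also have "\<dots> \<le> Gmax"
    unfolding G_def Gmax_def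
    by (rule vacuum_profile.potential_integral_le[OF frame_profile[OF T X X0z B(2)]]) (use T a \<delta> in auto)
  finally have "(1 + l * T) * (G0 / 2) \<le> Gmax" .
  moreover have "(1 + l * T) * (G0 / 2) = G0 / 2 + Gmax" using G0 l by (simp add: T_def field_simps)
  ultimately show False using G0 by simp
qed

end

theorem theorem1p1:
  fixes \<alpha> c \<rho>max :: real and \<rho>0 :: "real \<Rightarrow> real"
  assumes alpha: "0 < \<alpha>" "\<alpha> < 2"
    and c_pos: "c > 0"
    and smooth0: "smooth_real \<rho>0"
    and periodic0: "\<forall>x. \<rho>0 (x + 1) = \<rho>0 x"
    and nonzero: "\<exists>x. \<rho>0 x \<noteq> 0"
    and H1: "\<forall>x. \<rho>0 x = \<rho>0 (- x)"
    and H2: "\<rho>max > 0" "\<forall>x. 0 \<le> \<rho>0 x \<and> \<rho>0 x \<le> \<rho>max"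
    and H3: "\<rho>0 0 = 0" "\<forall>x\<in>{0..1/2}. deriv \<rho>0 x \<ge> 0"
  shows "\<not> (\<exists>\<rho> :: real \<Rightarrow> real \<Rightarrow> real.
             smooth_half (\<lambda>(x,t). \<rho> x t)
           \<and> (\<forall>x t. t \<ge> 0 \<longrightarrow> \<rho> (x + 1) t = \<rho> x t)
           \<and> (\<forall>x. \<rho> x 0 = \<rho>0 x)
           \<and> (\<forall>x t. t \<ge> 0 \<longrightarrow>
                (\<exists>d. ((\<lambda>s. \<rho> x s) has_real_derivative d) (at t within {0..})
                   \<and> ((\<lambda>y. \<rho> y t * velocity c \<alpha> (\<lambda>z. \<rho> z t) y)
                        has_real_derivative (- d)) (at x)))
           \<and> (\<exists>M. \<forall>x t. t \<ge> 0 \<longrightarrow>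
                \<bar>\<rho> x t\<bar> \<le> M \<and> \<bar>deriv (\<lambda>y. \<rho> y t) x\<bar> \<le> M))"
proof (intro notI, elim exE conjE)
  fix \<rho> M
  assume \<rho>: "smooth_half (\<lambda>(x,t). \<rho> x t)"
    "\<forall>x t. t \<ge> 0 \<longrightarrow> \<rho> (x + 1) t = \<rho> x t"
    "\<forall>x t. t \<ge> 0 \<longrightarrow>
                (\<exists>d. ((\<lambda>s. \<rho> x s) has_real_derivative d) (at t within {0..})
                   \<and> ((\<lambda>y. \<rho> y t * velocity c \<alpha> (\<lambda>z. \<rho> z t) y)
                        has_real_derivative (- d)) (at x))"
    "\<forall>x t. t \<ge> 0 \<longrightarrow> \<bar>\<rho> x t\<bar> \<le> M \<and> \<bar>deriv (\<lambda>y. \<rho> y t) x\<bar> \<le> M"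
    and init: "\<forall>x. \<rho> x 0 = \<rho>0 x"
  have "bounded_solution \<alpha> c M \<rho>"
  proof
    show "\<exists>d. ((\<lambda>s. \<rho> x s) has_real_derivative d) (at t within {0..})
        \<and> ((\<lambda>y. \<rho> y t * velocity c \<alpha> (\<lambda>z. \<rho> z t) y) has_real_derivative - d) (at x)"
      if "0 \<le> t" for x t by (rule \<rho>(3)[rule_format, OF that])
  qed (use alpha c_pos \<rho>(1,2,4) init H2(2) in simp_all)
  then interpret bounded_solution \<alpha> c M \<rho> by simp
  \<comment> \<open>\<open>vacuum_impossible\<close> asks for a zero to the left of a point of
    positive density; periodicity carries the zero at 0 arbitrarily far to the left.\<close>
  have shift: "\<rho>0 (- real n) = 0" for n
  proof (induction n)
    case (Suc n)
    then show ?case using periodic0[rule_format, of "- real (Suc n)"] by simp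
  qed (simp add: H3)
  obtain p where "\<rho>0 p \<noteq> 0" using nonzero by blast
  then have "0 < \<rho>0 p" using H2(2)[rule_format, of p] by simp
  moreover obtain n where "- p \<le> real n" using real_arch_simple by blast
  ultimately show False
    using vacuum_impossible[of "- real n" p] shift[of n] init by simp
qed

end
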